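(* Let $\alpha,\beta\in\mathbb{R}$, let $J\in\mathbb{Z}_+$ with $J>\alpha$, and let $N\in\mathbb{Z}_+$ be the minimal number such that $\beta\le N$. Let $g\in \mathrm{H}(\mathbb{D})$ and let $\varphi:\mathbb{D}\to\mathbb{D}$ be a holomorphic mapping. Then the weighted composition operator $C_\varphi^g:\Lambda^\beta(\mathbb{D})\to\Lambda^\alpha(\mathbb{D})$ is bounded if and only if both of the following hold: $$G_j[g,\varphi,J]\in\Lambda^{\alpha-J}(\mathbb{D}),\qquad j=0,1,\dots,\min\{N-1,J\},$$ $$\sup_{n\in\mathbb{Z}_+}\frac{\|G_j[g,\varphi,J]\,\varphi^n\|_{\Lambda^{\alpha-J}}}{\|z^n\|_{H^\infty_{\Omega_{j,\beta}}}}<\infty,\qquad j=N,\dots,J.$$ (A condition over an empty range of $j$ is void.)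
   Context: $\mathbb{D}$ is the open unit disk of $\mathbb{C}$, $\mathrm{H}(\mathbb{D})$ is the space of holomorphic functions on $\mathbb{D}$, and $\mathbb{Z}_+=\{0,1,2,\dots\}$. Spaces $\Lambda^\alpha$: for $\alpha\in\mathbb{R}$, $\Lambda^\alpha(\mathbb{D})$ is the space of $f\in \mathrm{H}(\mathbb{D})$ with $\sup_{z\in\mathbb{D}}|f^{(K)}(z)|(1-|z|)^{K-\alpha}<\infty$, where $K$ is a non-negative integer with $K>\alpha$ (the space does not depend on the choice of such $K$). It is a Banach space with norm $\|f\|_{\Lambda^\alpha}=\sum_{j=0}^{K-1}|f^{(j)}(0)|+\sup_{z\in\mathbb{D}}|f^{(K)}(z)|(1-|z|)^{K-\alpha}$, where $K$ is the smallest element of $\mathbb{Z}_+$ with $K>\alpha$ (the first sum is $0$ if $K=0$). In particular, for $\alpha<0$, $\|f\|_{\Lambda^\alpha}=\sup_{z\in\mathbb{D}}|f(z)|(1-|z|)^{-\alpha}$. Weighted composition operator: $(C_\varphi^g f)(z)=g(z)f(\varphi(z))$, $f\in \mathrm{H}(\mathbb{D})$, $z\in\mathbb{D}$. Boundedness from $\Lambda^\beta(\mathbb{D})$ to $\Lambda^\alpha(\mathbb{D})$ means that it maps $\Lambda^\beta(\mathbb{D})$ into $\Lambda^\alpha(\mathbb{D})$ and is a bounded operator between these Banach spaces. Functions $G_j$: for $J\in\mathbb{Z}_+$, the holomorphic functions $G_j[g,\varphi,J]$, $j=0,1,\dots,J$, depend only on $g,\varphi,J$ and are defined by the identity, valid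 for all $f\in \mathrm{H}(\mathbb{D})$ and obtained from the Leibniz rule and Faà di Bruno's formula, $(C_\varphi^g f)^{(J)}(z)=\sum_{j=0}^J G_j[g,\varphi,J](z)\,f^{(j)}(\varphi(z))$, $z\in\mathbb{D}$. For example, $G_0[g,\varphi,0]=g$; $G_0[g,\varphi,1]=g'$, $G_1[g,\varphi,1]=g\varphi'$; $G_0[g,\varphi,2]=g''$, $G_1[g,\varphi,2]=2g'\varphi'+g\varphi''$, $G_2[g,\varphi,2]=g(\varphi')^2$. Weight functions $\Omega_{j,\beta}:[0,1)\to(0,+\infty)$, $j=0,1,\dots,J$ (with $N$ the minimal element of $\mathbb{Z}_+$ with $N\ge\beta$): if $N>0$, then $\Omega_{j,\beta}\equiv1$ for $j=0,1,\dots,\min\{N-1,J\}$; if $\beta<N\le J$, then $\Omega_{j,\beta}(t)=(1-t)^{\beta-j}$ for $j=N,\dots,J$; if $\beta=N<J$, then $\Omega_{j,\beta}(t)=(1-t)^{\beta-j}$ for $j=N+1,\dots,J$; if $\beta=N\le J$, then $\Omega_{N,\beta}(t)=\log\frac{e}{1-t}$. Growth space norm: for $\omega:[0,1)\to(0,+\infty)$, $\|f\|_{H^\infty_\omega}=\sup_{z\in\mathbb{D}}|f(z)|/\omega(|z|)$; $z^n$ denotes the monomial function. *)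

theory Defs
  imports "HOL-Complex_Analysis.Complex_Analysis"
begin

text \<open>
  Functions on the unit disk are represented by total functions \<^typ>\<open>complex \<Rightarrow> complex\<close>;
  every notion below looks only at values at points of the disk (which is open, so
  iterated derivatives at its points are determined by these values as well).
  Norms take values in \<^typ>\<open>ennreal\<close>, so that suprema are honest suprema and
  "finite" means \<^term>\<open>x < (\<infinity> :: ennreal)\<close>.
\<close>

abbreviation unit_disk :: "complex set" where
  "unit_disk \<equiv> ball 0 1"

definition Lambda_order :: "real \<Rightarrow> nat" where
  "Lambda_order \<alpha> = (LEAST K. real K > \<alpha>)"

definition Lambda_seminorm :: "real \<Rightarrow> (complex \<Rightarrow> complex) \<Rightarrow> ennreal" where
  "Lambda_seminorm \<alpha> f =
     (let K = Lambda_order \<alpha> in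
      (SUP z\<in>unit_disk. ennreal (norm ((deriv ^^ K) f z) * (1 - norm z) powr (real K - \<alpha>))))"

text \<open>
  The space does not depend on the choice of the integer \<open>K > \<alpha>\<close> used to define it; the
  smallest one is used here, as in the norm.
\<close>

definition Lambda_space :: "real \<Rightarrow> (complex \<Rightarrow> complex) set" where
  "Lambda_space \<alpha> = {f. f holomorphic_on unit_disk \<and> Lambda_seminorm \<alpha> f < \<infinity>}"

definition Lambda_norm :: "real \<Rightarrow> (complex \<Rightarrow> complex) \<Rightarrow> ennreal" where
  "Lambda_norm \<alpha> f =
     (\<Sum>j<Lambda_order \<alpha>. ennreal (norm ((deriv ^^ j) f 0))) + Lambda_seminorm \<alpha> f"

definition weighted_comp ::
  "(complex \<Rightarrow> complex) \<Rightarrow> (complex \<Rightarrow> complex) \<Rightarrow> (complex \<Rightarrow> complex) \<Rightarrow> complex \<Rightarrow> complex" where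
  "weighted_comp g \<phi> f = (\<lambda>z. g z * f (\<phi> z))"

text \<open>
  Boundedness of an operator (assumed linear, as \<^const>\<open>weighted_comp\<close> is by its pointwise formula).
\<close>

definition bounded_Lambda_operator ::
  "real \<Rightarrow> real \<Rightarrow> ((complex \<Rightarrow> complex) \<Rightarrow> complex \<Rightarrow> complex) \<Rightarrow> bool" where
  "bounded_Lambda_operator \<beta> \<alpha> T \<longleftrightarrow>
     (\<forall>f\<in>Lambda_space \<beta>. T f \<in> Lambda_space \<alpha>) \<and>
     (\<exists>C\<ge>0. \<forall>f\<in>Lambda_space \<beta>. Lambda_norm \<alpha> (T f) \<le> ennreal C * Lambda_norm \<beta> f)"

definition is_Gcoeffs ::
  "(complex \<Rightarrow> complex) \<Rightarrow> (complex \<Rightarrow> complex) \<Rightarrow> nat \<Rightarrow> (nat \<Rightarrow> complex \<Rightarrow> complex) \<Rightarrow> bool" where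
  "is_Gcoeffs g \<phi> J G \<longleftrightarrow>
     (\<forall>j\<le>J. G j holomorphic_on unit_disk) \<and>
     (\<forall>f. f holomorphic_on unit_disk \<longrightarrow>
        (\<forall>z\<in>unit_disk. (deriv ^^ J) (weighted_comp g \<phi> f) z =
           (\<Sum>j\<le>J. G j z * (deriv ^^ j) f (\<phi> z))))"

text \<open>
  The defining identity of the functions \<open>G\<^sub>j[g, \<phi>, J]\<close>, \<open>j \<le> J\<close>, has a solution, and it
  determines their values on the disk: see \<open>is_Gcoeffs_exists\<close> and \<open>is_Gcoeffs_unique\<close> below.
\<close>

definition Gcoeff ::
  "(complex \<Rightarrow> complex) \<Rightarrow> (complex \<Rightarrow> complex) \<Rightarrow> nat \<Rightarrow> nat \<Rightarrow> complex \<Rightarrow> complex" where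
  "Gcoeff g \<phi> J = (SOME G. is_Gcoeffs g \<phi> J G)"

lemma is_Gcoeffs_exists:
  assumes g: "g holomorphic_on unit_disk" and \<phi>: "\<phi> holomorphic_on unit_disk"
    and im: "\<phi> ` unit_disk \<subseteq> unit_disk"
  shows "\<exists>G. is_Gcoeffs g \<phi> J G"
proof (induction J)
  case 0
  show ?case
    by (rule exI[of _ "\<lambda>_. g"]) (simp add: is_Gcoeffs_def weighted_comp_def g)
next
  case (Suc J)
  then obtain G0 where G0: "is_Gcoeffs g \<phi> J G0" by blast
  define G where "G j = (if j \<le> J then G0 j else (\<lambda>_. 0))" for j
  have hol: "G j holomorphic_on unit_disk" for j
    using G0 by (auto simp: G_def is_Gcoeffs_def)
  have idG: "(deriv ^^ J) (weighted_comp g \<phi> f) z = (\<Sum>j\<le>J. G j z * (deriv ^^ j) f (\<phi> z))"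
    if "f holomorphic_on unit_disk" "z \<in> unit_disk" for f z
    using G0 that unfolding is_Gcoeffs_def by (auto simp: G_def intro!: sum.cong)
  define H where "H j z = deriv (G j) z + (if j = 0 then 0 else G (j - 1) z * deriv \<phi> z)" for j z
  have "H j holomorphic_on unit_disk" for j
  proof (cases "j = 0")
    case True
    then show ?thesis
      using holomorphic_deriv[OF hol open_ball] by (simp add: H_def[abs_def])
  next
    case False
    have "(\<lambda>z. deriv (G j) z + G (j - 1) z * deriv \<phi> z) holomorphic_on unit_disk"
      by (intro holomorphic_intros hol \<phi>) auto
    with False show ?thesis by (simp add: H_def[abs_def])
  qed
  moreover have "(deriv ^^ Suc J) (weighted_comp g \<phi> f) z = (\<Sum>j\<le>Suc J. H j z * (deriv ^^ j) f (\<phi> z))"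
    if f: "f holomorphic_on unit_disk" and z: "z \<in> unit_disk" for f z
  proof -
    have \<phi>z: "\<phi> z \<in> unit_disk" using im z by blast
    have ev: "eventually (\<lambda>w. (deriv ^^ J) (weighted_comp g \<phi> f) w =
        (\<Sum>j\<le>J. G j w * (deriv ^^ j) f (\<phi> w))) (nhds z)"
      using eventually_nhds_in_open[OF open_ball z] by eventually_elim (rule idG[OF f])
    have dG: "(G j has_field_derivative deriv (G j) z) (at z)" for j
      using holomorphic_derivI[OF hol open_ball z] .
    have d\<phi>: "(\<phi> has_field_derivative deriv \<phi> z) (at z)"
      using holomorphic_derivI[OF \<phi> open_ball z] .
    have df: "((deriv ^^ j) f has_field_derivative (deriv ^^ Suc j) f (\<phi> z)) (at (\<phi> z))" for j
      using holomorphic_derivI[OF holomorphic_higher_deriv[OF f open_ball] open_ball \<phi>z] by simp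
    have dcomp: "((\<lambda>w. (deriv ^^ j) f (\<phi> w)) has_field_derivative
        (deriv ^^ Suc j) f (\<phi> z) * deriv \<phi> z) (at z)" for j
      using DERIV_chain2[OF df d\<phi>] .
    have "((\<lambda>w. \<Sum>j\<le>J. G j w * (deriv ^^ j) f (\<phi> w)) has_field_derivative
        (\<Sum>j\<le>J. deriv (G j) z * (deriv ^^ j) f (\<phi> z) +
          ((deriv ^^ Suc j) f (\<phi> z) * deriv \<phi> z) * G j z)) (at z)"
      by (intro DERIV_sum DERIV_mult dG dcomp)
    then have "deriv (\<lambda>w. \<Sum>j\<le>J. G j w * (deriv ^^ j) f (\<phi> w)) z =
        (\<Sum>j\<le>J. deriv (G j) z * (deriv ^^ j) f (\<phi> z) +
          ((deriv ^^ Suc j) f (\<phi> z) * deriv \<phi> z) * G j z)"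
      by (rule DERIV_imp_deriv)
    then have "(deriv ^^ Suc J) (weighted_comp g \<phi> f) z =
        (\<Sum>j\<le>J. deriv (G j) z * (deriv ^^ j) f (\<phi> z)) +
        (\<Sum>j\<le>J. G j z * deriv \<phi> z * (deriv ^^ Suc j) f (\<phi> z))"
      using deriv_cong_ev[OF ev refl] by (simp add: sum.distrib mult_ac)
    also have "(\<Sum>j\<le>J. deriv (G j) z * (deriv ^^ j) f (\<phi> z)) =
        (\<Sum>j\<le>Suc J. deriv (G j) z * (deriv ^^ j) f (\<phi> z))"
      by (simp add: G_def)
    also have "(\<Sum>j\<le>J. G j z * deriv \<phi> z * (deriv ^^ Suc j) f (\<phi> z)) =
        (\<Sum>j\<le>Suc J. (if j = 0 then 0 else G (j - 1) z * deriv \<phi> z) * (deriv ^^ j) f (\<phi> z))"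
      by (subst sum.atMost_Suc_shift) simp
    finally show ?thesis
      by (simp add: H_def sum.distrib distrib_right del: sum.atMost_Suc funpow.simps)
  qed
  ultimately have "is_Gcoeffs g \<phi> (Suc J) H"
    unfolding is_Gcoeffs_def by blast
  then show ?case by blast
qed

lemma is_Gcoeffs_unique:
  assumes G: "is_Gcoeffs g \<phi> J G" and H: "is_Gcoeffs g \<phi> J H"
    and z: "z \<in> unit_disk" and j: "j \<le> J"
  shows "G j z = H j z"
proof -
  let ?f = "\<lambda>w. (w - \<phi> z) ^ j"
  have f: "?f holomorphic_on unit_disk" by (intro holomorphic_intros)
  have d: "(deriv ^^ i) ?f (\<phi> z) = (if i = j then fact j else 0)" for i
  proof -
    have "(deriv ^^ i) ?f (\<phi> z) = pochhammer (of_nat (Suc j - i)) i * (\<phi> z - \<phi> z) ^ (j - i)"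
      by (rule higher_deriv_power)
    then show ?thesis
      by (cases i j rule: linorder_cases) (simp_all add: pochhammer_fact pochhammer_0_left)
  qed
  have *: "(deriv ^^ J) (weighted_comp g \<phi> ?f) z = F j z * fact j" if "is_Gcoeffs g \<phi> J F" for F
  proof -
    have "(deriv ^^ J) (weighted_comp g \<phi> ?f) z = (\<Sum>i\<le>J. F i z * (deriv ^^ i) ?f (\<phi> z))"
      using that f z unfolding is_Gcoeffs_def by blast
    also have "\<dots> = (\<Sum>i\<le>J. if i = j then F j z * fact j else 0)"
      by (rule sum.cong) (simp_all only: d, simp)
    also have "\<dots> = F j z * fact j"
      using j by simp
    finally show ?thesis .
  qed
  show ?thesis using *[OF G] *[OF H] by simp
qed

definition min_nat_ge :: "real \<Rightarrow> nat" where
  "min_nat_ge \<beta> = (LEAST N. \<beta> \<le> real N)"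

text \<open>
  The formula does not involve \<open>J\<close>, which only restricts the range of the index \<open>j\<close>.
  The argument \<open>t\<close> is meant to range over \<open>0 \<le> t < 1\<close>.
\<close>

definition Omega :: "nat \<Rightarrow> real \<Rightarrow> real \<Rightarrow> real" where
  "Omega j \<beta> t =
     (let N = min_nat_ge \<beta> in
      if j < N then 1
      else if j = N \<and> \<beta> = real N then ln (exp 1 / (1 - t))
      else (1 - t) powr (\<beta> - real j))"

definition growth_norm :: "(real \<Rightarrow> real) \<Rightarrow> (complex \<Rightarrow> complex) \<Rightarrow> ennreal" where
  "growth_norm \<omega> f = (SUP z\<in>unit_disk. ennreal (norm (f z) / \<omega> (norm z)))"

end

theory Submission
  imports Defs
begin

text \<open>
  Since \<open>\<alpha> - J < 0\<close>, boundedness of \<open>f \<mapsto> g \<cdot> (f \<circ> \<phi>)\<close> amounts to a bound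
  for the \<open>J\<close>-th derivative \<open>\<Sum>j\<le>J. G\<^sub>j (z) f\<^sup>(\<^sup>j\<^sup>) (\<phi> z)\<close> by a multiple of \<open>(1 - |z|)\<close> to the
  power \<open>\<alpha> - J\<close>. The optimal pointwise growth of \<open>f\<^sup>(\<^sup>j\<^sup>)\<close> for \<open>f\<close> in the unit ball of
  \<open>\<Lambda>\<^sup>\<beta>\<close> is \<open>\<Omega>\<^sub>j\<close>, so boundedness is equivalent to
  \<open>|G\<^sub>j (z)| \<Omega>\<^sub>j (|\<phi> z|) \<le> C (1 - |z|)\<close> to the power \<open>\<alpha> - J\<close>, for every \<open>j \<le> J\<close>. Necessity uses
  test functions of the form \<open>(z - w)\<^sup>j h (z)\<close> with \<open>w = \<phi> z\<close>. Finally
  \<open>\<Omega>\<^sub>j (t)\<close> is comparable to the supremum over \<open>n\<close> of \<open>t\<^sup>n\<close> divided by the norm of the monomial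
  of degree \<open>n\<close>, which turns the pointwise bound into the condition on the functions \<open>G\<^sub>j \<phi>\<^sup>n\<close>.
\<close>

section \<open>Real-valued form of the norms\<close>

lemma less_min_nat_ge_iff: "j < min_nat_ge \<beta> \<longleftrightarrow> real j < \<beta>"
proof
  assume "j < min_nat_ge \<beta>"
  then show "real j < \<beta>" using not_less_Least unfolding min_nat_ge_def by force
next
  assume a: "real j < \<beta>"
  have "\<beta> \<le> real (min_nat_ge \<beta>)" unfolding min_nat_ge_def by (rule LeastI_ex[OF real_arch_simple])
  with a show "j < min_nat_ge \<beta>" by linarith
qed

text \<open>An integer \<beta> is its own \<open>min_nat_ge\<close>, so the logarithmic case is just
  j = \<beta>. Thus \<open>N\<close> disappears, and comparing j with \<beta> decides everything
  below.\<close>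

lemma Omega_eq:
  assumes "t < 1"
  shows "Omega j \<beta> t = (if real j < \<beta> then 1 else if real j = \<beta> then 1 - ln (1 - t)
     else (1 - t) powr (\<beta> - real j))"
proof -
  have "j = min_nat_ge \<beta> \<and> \<beta> = real (min_nat_ge \<beta>) \<longleftrightarrow> real j = \<beta>"
  proof
    assume a: "real j = \<beta>"
    have "min_nat_ge \<beta> = j" unfolding min_nat_ge_def
      by (rule Least_equality) (use a in auto)
    then show "j = min_nat_ge \<beta> \<and> \<beta> = real (min_nat_ge \<beta>)" using a by simp
  qed auto
  moreover have "ln (exp 1 / (1 - t)) = 1 - ln (1 - t)"
    using assms by (simp add: ln_div)
  ultimately show ?thesis unfolding Omega_def Let_def less_min_nat_ge_iff by simp
qed

lemma Lambda_order_le_iff: "Lambda_order \<alpha> \<le> j \<longleftrightarrow> \<alpha> < real j"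
proof
  assume "Lambda_order \<alpha> \<le> j"
  moreover have "\<alpha> < real (Lambda_order \<alpha>)"
    unfolding Lambda_order_def by (rule LeastI_ex[OF reals_Archimedean2])
  ultimately show "\<alpha> < real j" by linarith
next
  assume "\<alpha> < real j"
  then show "Lambda_order \<alpha> \<le> j" unfolding Lambda_order_def by (rule Least_le)
qed

lemma Omega_pos: "0 < Omega j \<beta> t" if "0 \<le> t" "t < 1"
proof -
  have "ln (1 - t) < 1" using that ln_le_zero_iff[of "1 - t"] by linarith
  then show ?thesis using that by (auto simp: Omega_eq)
qed

text \<open>Real-valued substitute for \<open>Lambda_norm \<alpha> f \<le> A\<close>, holomorphy
  included. Bounding the terms of the norm separately costs only the factor
  \<open>Lambda_order \<alpha> + 1\<close>.\<close>

definition Lambda_bound :: "real \<Rightarrow> (complex \<Rightarrow> complex) \<Rightarrow> real \<Rightarrow> bool" where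
  "Lambda_bound \<alpha> f A \<longleftrightarrow> f holomorphic_on unit_disk \<and>
     (\<forall>j<Lambda_order \<alpha>. norm ((deriv ^^ j) f 0) \<le> A) \<and>
     (\<forall>z\<in>unit_disk. norm ((deriv ^^ Lambda_order \<alpha>) f z)
        \<le> A * (1 - norm z) powr (\<alpha> - real (Lambda_order \<alpha>)))"

lemma mult_powr_le_iff: "x * u powr s \<le> A \<longleftrightarrow> x \<le> A * u powr (- s)" if "0 < u" for x u s A :: real
  using that by (simp add: powr_minus field_simps)

lemma Lambda_seminorm_le_iff:
  "Lambda_seminorm \<alpha> f \<le> ennreal A \<longleftrightarrow> (\<forall>z\<in>unit_disk. norm ((deriv ^^ Lambda_order \<alpha>) f z)
        \<le> A * (1 - norm z) powr (\<alpha> - real (Lambda_order \<alpha>)))" if "0 \<le> A"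
  unfolding Lambda_seminorm_def Let_def SUP_le_iff
  using that by (intro ball_cong refl) (simp add: ennreal_le_iff mult_powr_le_iff)

lemma Lambda_norm_imp_bound:
  assumes "f holomorphic_on unit_disk" "Lambda_norm \<alpha> f \<le> ennreal A" "0 \<le> A"
  shows "Lambda_bound \<alpha> f A"
proof -
  let ?S = "\<Sum>j<Lambda_order \<alpha>. ennreal (norm ((deriv ^^ j) f 0))"
  have le: "?S \<le> ennreal A" "Lambda_seminorm \<alpha> f \<le> ennreal A"
    using assms(2) unfolding Lambda_norm_def
    by (meson add_increasing add_increasing2 order_trans order_refl zero_le)+
  have "norm ((deriv ^^ j) f 0) \<le> A" if "j < Lambda_order \<alpha>" for j
  proof -
    have "ennreal (norm ((deriv ^^ j) f 0)) \<le> ?S"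
      using that by (intro member_le_sum) auto
    with le(1) have "ennreal (norm ((deriv ^^ j) f 0)) \<le> ennreal A" by (rule order_trans[rotated])
    then show ?thesis using assms(3) by simp
  qed
  with assms le(2) show ?thesis
    by (simp add: Lambda_bound_def Lambda_seminorm_le_iff)
qed

lemma Lambda_space_imp_norm_finite:
  assumes "f \<in> Lambda_space \<alpha>" shows "Lambda_norm \<alpha> f < \<infinity>"
  using assms unfolding Lambda_space_def Lambda_norm_def by (simp add: less_top[symmetric])

lemma Lambda_bound_imp_space:
  assumes "Lambda_bound \<alpha> f A" "0 \<le> A"
  shows "f \<in> Lambda_space \<alpha>" "Lambda_norm \<alpha> f \<le> ennreal ((real (Lambda_order \<alpha>) + 1) * A)"
proof -
  have s: "Lambda_seminorm \<alpha> f \<le> ennreal A"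
    using assms by (simp add: Lambda_bound_def Lambda_seminorm_le_iff)
  then have "Lambda_seminorm \<alpha> f < \<infinity>" by (simp add: order_le_less_trans)
  then show "f \<in> Lambda_space \<alpha>" using assms by (simp add: Lambda_space_def Lambda_bound_def)
  have "(\<Sum>j<Lambda_order \<alpha>. ennreal (norm ((deriv ^^ j) f 0))) \<le> (\<Sum>j<Lambda_order \<alpha>. ennreal A)"
    using assms by (intro sum_mono ennreal_leI) (simp add: Lambda_bound_def)
  also have "\<dots> = ennreal (real (Lambda_order \<alpha>) * A)"
    using assms(2) by (subst sum_ennreal) auto
  finally have "Lambda_norm \<alpha> f \<le> ennreal (real (Lambda_order \<alpha>) * A) + ennreal A"
    unfolding Lambda_norm_def using s by (rule add_mono)
  also have "\<dots> = ennreal ((real (Lambda_order \<alpha>) + 1) * A)"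
    using assms(2) by (subst ennreal_plus[symmetric]) (auto simp: algebra_simps)
  finally show "Lambda_norm \<alpha> f \<le> ennreal ((real (Lambda_order \<alpha>) + 1) * A)" .
qed

lemma weighted_comp_holomorphic:
  assumes "g holomorphic_on unit_disk" "\<phi> holomorphic_on unit_disk" "\<phi> ` unit_disk \<subseteq> unit_disk"
    and "f holomorphic_on unit_disk"
  shows "weighted_comp g \<phi> f holomorphic_on unit_disk"
  unfolding weighted_comp_def
  using holomorphic_on_compose_gen[OF assms(2,4,3)] assms(1)
  by (auto intro!: holomorphic_intros simp: o_def)

text \<open>\<open>Lambda_norm\<close> and \<open>Lambda_bound\<close> control each other up to
  constants depending only on the parameters, and the operator constant absorbs these. Both
  directions of the criterion can then use real inequalities.\<close>

lemma bounded_Lambda_operator_iff: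
  assumes hol: "\<And>f. f holomorphic_on unit_disk \<Longrightarrow> T f holomorphic_on unit_disk"
  shows "bounded_Lambda_operator \<beta> \<alpha> T \<longleftrightarrow>
    (\<exists>C\<ge>0. \<forall>f A. 0 \<le> A \<longrightarrow> Lambda_bound \<beta> f A \<longrightarrow> Lambda_bound \<alpha> (T f) (C * A))"
proof
  assume "bounded_Lambda_operator \<beta> \<alpha> T"
  then obtain C where C: "0 \<le> C"
    "\<And>f. f \<in> Lambda_space \<beta> \<Longrightarrow> Lambda_norm \<alpha> (T f) \<le> ennreal C * Lambda_norm \<beta> f"
    unfolding bounded_Lambda_operator_def by blast
  define K where "K = real (Lambda_order \<beta>) + 1"
  have "Lambda_bound \<alpha> (T f) (C * K * A)" if "0 \<le> A" "Lambda_bound \<beta> f A" for f A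
  proof (rule Lambda_norm_imp_bound)
    show "T f holomorphic_on unit_disk"
      using that hol by (simp add: Lambda_bound_def)
    have "Lambda_norm \<alpha> (T f) \<le> ennreal C * Lambda_norm \<beta> f"
      using C(2) Lambda_bound_imp_space(1) that by blast
    also have "\<dots> \<le> ennreal C * ennreal (K * A)"
      using Lambda_bound_imp_space(2)[OF that(2,1)] by (intro mult_left_mono) (auto simp: K_def)
    also have "\<dots> = ennreal (C * K * A)"
      using C(1) that(1) by (subst ennreal_mult[symmetric]) (auto simp: K_def mult.assoc)
    finally show "Lambda_norm \<alpha> (T f) \<le> ennreal (C * K * A)" .
    show "0 \<le> C * K * A" using C(1) that(1) by (simp add: K_def)
  qed
  then show "\<exists>C\<ge>0. \<forall>f A. 0 \<le> A \<longrightarrow> Lambda_bound \<beta> f A \<longrightarrow> Lambda_bound \<alpha> (T f) (C * A)"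
    using C(1) by (intro exI[of _ "C * K"]) (auto simp: K_def)
next
  assume "\<exists>C\<ge>0. \<forall>f A. 0 \<le> A \<longrightarrow> Lambda_bound \<beta> f A \<longrightarrow> Lambda_bound \<alpha> (T f) (C * A)"
  then obtain C where C: "0 \<le> C"
    "\<And>f A. 0 \<le> A \<Longrightarrow> Lambda_bound \<beta> f A \<Longrightarrow> Lambda_bound \<alpha> (T f) (C * A)" by blast
  define K where "K = real (Lambda_order \<alpha>) + 1"
  have "T f \<in> Lambda_space \<alpha> \<and> Lambda_norm \<alpha> (T f) \<le> ennreal (K * C) * Lambda_norm \<beta> f"
    if f: "f \<in> Lambda_space \<beta>" for f
  proof -
    obtain A where A: "0 \<le> A" "Lambda_norm \<beta> f = ennreal A"
      using Lambda_space_imp_norm_finite[OF f] by (cases "Lambda_norm \<beta> f") auto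
    have "Lambda_bound \<beta> f A"
      using f A by (intro Lambda_norm_imp_bound) (auto simp: Lambda_space_def)
    then have "Lambda_bound \<alpha> (T f) (C * A)" using C(2) A(1) by blast
    from Lambda_bound_imp_space[OF this] C(1) A show ?thesis
      by (simp add: K_def ennreal_mult[symmetric] mult.assoc)
  qed
  then show "bounded_Lambda_operator \<beta> \<alpha> T"
    unfolding bounded_Lambda_operator_def using C(1)
    by (intro conjI exI[of _ "K * C"]) (auto simp: K_def)
qed

section \<open>Growth of derivatives\<close>

text \<open>Cauchy's inequality on the disc about z with half the distance to the boundary as
  radius: there the weight grows by at most \<open>2 powr s\<close>, and each derivative costs
  \<open>1 / r\<close>.\<close>

lemma Cauchy_growth_estimate:
  fixes s :: real
  assumes h: "h holomorphic_on unit_disk" and s: "0 \<le> s"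
    and bd: "\<And>z. z \<in> unit_disk \<Longrightarrow> norm (h z) \<le> A * (1 - norm z) powr (- s)"
    and z: "z \<in> unit_disk"
  shows "norm ((deriv ^^ i) h z) \<le> fact i * 2 powr (s + real i) * A * (1 - norm z) powr (- s - real i)"
proof -
  define r where "r = (1 - norm z) / 2"
  have r: "0 < r" using z by (simp add: r_def)
  \<comment> \<open>Nonnegativity of \<open>A\<close> comes from the bound at the origin, where the
    weight is 1.\<close>
  have "0 \<le> norm (h 0)" by simp
  also have "norm (h 0) \<le> A" using bd[of 0] by simp
  finally have A: "0 \<le> A" .
  have le: "1 - norm w \<ge> r" if "dist z w \<le> r" for w
    using that norm_triangle_ineq2[of w z] by (simp add: r_def dist_norm norm_minus_commute)
  have sub: "cball z r \<subseteq> unit_disk"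
    using le r by (force simp: dist_norm)
  have "norm ((deriv ^^ i) h z) \<le> fact i * (A * r powr (- s)) / r ^ i"
  proof (rule Cauchy_inequality)
    show "h holomorphic_on ball z r"
      by (rule holomorphic_on_subset[OF h]) (use sub ball_subset_cball in blast)
    show "continuous_on (cball z r) h"
      by (rule holomorphic_on_imp_continuous_on[OF holomorphic_on_subset[OF h sub]])
    show "norm (h x) \<le> A * r powr (- s)" if "norm (z - x) = r" for x
    proof -
      have "norm (h x) \<le> A * (1 - norm x) powr (- s)"
        using sub that by (intro bd) (auto simp: dist_norm)
      also have "\<dots> \<le> A * r powr (- s)"
        using A r s le[of x] that by (intro mult_left_mono powr_mono2') (auto simp: dist_norm)
      finally show ?thesis .
    qed
  qed (rule r)
  also have "\<dots> = fact i * A * r powr (- s - real i)"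
    using r by (simp add: powr_diff powr_realpow)
  also have "r powr (- s - real i) = 2 powr (s + real i) * (1 - norm z) powr (- s - real i)"
    using z by (simp add: r_def powr_divide powr_diff powr_add powr_minus field_simps)
  finally show ?thesis by (simp add: mult_ac)
qed

text \<open>\<open>\<psi>\<close> is an antiderivative of the majorant. The mean value inequality
  for h(xz) against \<psi>(x|z|), x from 0 to 1, replaces integration along the radius.\<close>

lemma holomorphic_growth_integral:
  fixes \<psi> \<psi>' :: "real \<Rightarrow> real"
  assumes h: "h holomorphic_on unit_disk"
    and bd: "\<And>z. z \<in> unit_disk \<Longrightarrow> norm (deriv h z) \<le> \<psi>' (norm z)"
    and \<psi>: "\<And>t. 0 \<le> t \<Longrightarrow> t < 1 \<Longrightarrow> (\<psi> has_real_derivative \<psi>' t) (at t)"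
    and z: "z \<in> unit_disk"
  shows "norm (h z) \<le> norm (h 0) + (\<psi> (norm z) - \<psi> 0)"
proof -
  have in_disk: "of_real x * z \<in> unit_disk" if "0 \<le> x" "x \<le> 1" for x :: real
    using that z mult_right_mono[of x 1 "norm z"] by (simp add: norm_mult)
  have hd: "((\<lambda>x::real. h (of_real x * z)) has_vector_derivative (z * deriv h (of_real x * z))) (at x)"
    if "0 \<le> x" "x \<le> 1" for x
  proof -
    have "(h has_field_derivative deriv h (of_real x * z)) (at (of_real x * z))"
      by (rule holomorphic_derivI[OF h open_ball in_disk[OF that]])
    moreover have "((\<lambda>x::real. of_real x * z) has_vector_derivative z) (at x)"
      by (auto intro!: derivative_eq_intros)
    ultimately show ?thesis
      using field_vector_diff_chain_at[of "\<lambda>x::real. of_real x * z" z x h] by (simp add: o_def)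
  qed
  have \<psi>d: "((\<lambda>x. \<psi> (x * norm z)) has_real_derivative \<psi>' (x * norm z) * norm z) (at x)"
    if "0 \<le> x" "x \<le> 1" for x
  proof -
    have "x * norm z < 1" using in_disk[OF that] that by (simp add: norm_mult)
    then show ?thesis
      using that by (auto intro!: DERIV_chain2[OF \<psi>] derivative_eq_intros)
  qed
  have "norm (h (of_real 1 * z) - h (of_real 0 * z)) \<le> \<psi> (1 * norm z) - \<psi> (0 * norm z)"
  proof (rule differentiable_bound_general[where f = "\<lambda>x. h (of_real x * z)"
        and \<phi> = "\<lambda>x. \<psi> (x * norm z)" and \<phi>' = "\<lambda>x. \<psi>' (x * norm z) * norm z" and f' = "\<lambda>x. z * deriv h (of_real x * z)"])
    show "continuous_on {0..1} (\<lambda>x. h (of_real x * z))"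
      by (intro continuous_at_imp_continuous_on ballI has_vector_derivative_continuous[OF hd]) auto
    show "continuous_on {0..1} (\<lambda>x. \<psi> (x * norm z))"
      by (intro continuous_at_imp_continuous_on ballI DERIV_isCont[OF \<psi>d]) auto
    fix x :: real assume x: "0 < x" "x < 1"
    show "((\<lambda>x. h (of_real x * z)) has_vector_derivative z * deriv h (of_real x * z)) (at x)"
      using hd x by simp
    show "((\<lambda>x. \<psi> (x * norm z)) has_vector_derivative \<psi>' (x * norm z) * norm z) (at x)"
      using \<psi>d[of x] x by (simp add: has_real_derivative_iff_has_vector_derivative)
    show "norm (z * deriv h (of_real x * z)) \<le> \<psi>' (x * norm z) * norm z"
      using bd[OF in_disk, of x] x by (simp add: norm_mult mult.commute mult_left_mono)
  qed simp
  then show ?thesis using norm_triangle_ineq2[of "h z" "h 0"] by simp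
qed

text \<open>Both signs of s are wanted: s > 0 yields growth of order
  \<open>(1 - norm z) powr (- s)\<close>, s < 0 a bounded function.\<close>

lemma growth_integral_power:
  assumes h: "h holomorphic_on unit_disk" and s: "s \<noteq> 0"
    and bd: "\<And>z. z \<in> unit_disk \<Longrightarrow> norm (deriv h z) \<le> A * (1 - norm z) powr (- s - 1)"
    and z: "z \<in> unit_disk"
  shows "norm (h z) \<le> norm (h 0) + A * (((1 - norm z) powr (- s) - 1) / s)"
proof -
  have "norm (h z) \<le> norm (h 0) + (A * (1 - norm z) powr (- s) / s - A * (1 - 0) powr (- s) / s)"
    by (rule holomorphic_growth_integral[OF h bd _ z])
       (use s in \<open>auto intro!: derivative_eq_intros simp: field_simps powr_diff\<close>)
  then show ?thesis by (simp add: algebra_simps diff_divide_distrib)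
qed

text \<open>The exponent missing in \<open>growth_integral_power\<close>: here the antiderivative is
  a logarithm, the source of the logarithmic weight at j = \<beta>.\<close>

lemma growth_integral_log:
  assumes h: "h holomorphic_on unit_disk"
    and bd: "\<And>z. z \<in> unit_disk \<Longrightarrow> norm (deriv h z) \<le> A * (1 - norm z) powr (- 1)"
    and z: "z \<in> unit_disk"
  shows "norm (h z) \<le> norm (h 0) - A * ln (1 - norm z)"
proof -
  have "norm (h z) \<le> norm (h 0) + (- A * ln (1 - norm z) - (- A * ln (1 - 0)))"
    by (rule holomorphic_growth_integral[OF h bd _ z])
       (auto intro!: derivative_eq_intros simp: field_simps powr_minus)
  then show ?thesis by simp
qed

text \<open>For j < \<beta> the next weight has an integrable majorant, so that one integration
  gives a bounded derivative. The cap 1/2 in \<open>\<delta>\<close> leaves room for the logarithm,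
  and the factor 2 absorbs it.\<close>

lemma Omega_Suc_le:
  assumes "real j < \<beta>"
  obtains \<delta> :: real where "0 < \<delta>" "\<And>t. 0 \<le> t \<Longrightarrow> t < 1 \<Longrightarrow> Omega (Suc j) \<beta> t \<le> 2 * (1 - t) powr (\<delta> - 1)"
proof
  define \<delta> where "\<delta> = min (1/2) (\<beta> - real j)"
  show "0 < \<delta>" using assms by (simp add: \<delta>_def)
  fix t :: real assume t: "0 \<le> t" "t < 1"
  have one: "1 \<le> (1 - t) powr s" if "s \<le> 0" for s
    using t that powr_mono'[of s 0 "1 - t"] by simp
  consider "real (Suc j) < \<beta>" | "real (Suc j) = \<beta>" | "\<beta> < real (Suc j)" by linarith
  then show "Omega (Suc j) \<beta> t \<le> 2 * (1 - t) powr (\<delta> - 1)"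
  proof cases
    case 1
    then show ?thesis using t one[of "\<delta> - 1"] by (simp add: Omega_eq \<delta>_def)
  next
    case 2
    then have \<delta>: "\<delta> - 1 = - (1/2)" by (auto simp: \<delta>_def)
    have "ln ((1 - t) powr (- (1/2))) \<le> (1 - t) powr (- (1/2)) - 1"
      using t by (intro ln_le_minus_one) simp
    then have "1 - ln (1 - t) \<le> 2 * (1 - t) powr (- (1/2))"
      using t one[of "-(1/2)"] by (simp add: ln_powr)
    then show ?thesis using t 2 unfolding \<delta> by (simp add: Omega_eq)
  next
    case 3
    have "(1 - t) powr (\<beta> - real (Suc j)) \<le> (1 - t) powr (\<delta> - 1)"
      using t by (intro powr_mono') (auto simp: \<delta>_def)
    also have "\<dots> \<le> 2 * (1 - t) powr (\<delta> - 1)" by simp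
    finally show ?thesis using t 3 by (simp add: Omega_eq)
  qed
qed

text \<open>Cauchy estimates give the bound for \<open>\<beta> < j\<close>; integrating along radii carries it down to the smaller \<open>j\<close>.\<close>

lemma Lambda_pointwise:
  "\<exists>C\<ge>0. \<forall>f A. 0 \<le> A \<longrightarrow> Lambda_bound \<beta> f A \<longrightarrow>
     (\<forall>z\<in>unit_disk. norm ((deriv ^^ j) f z) \<le> C * A * Omega j \<beta> (norm z))"
proof -
  define K where "K = Lambda_order \<beta>"
  have K: "\<beta> < real K" unfolding K_def using Lambda_order_le_iff by blast
  have high: "\<exists>C\<ge>0. \<forall>f A. 0 \<le> A \<longrightarrow> Lambda_bound \<beta> f A \<longrightarrow>
     (\<forall>z\<in>unit_disk. norm ((deriv ^^ j) f z) \<le> C * A * Omega j \<beta> (norm z))"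
    if "\<beta> < real j" for j
  proof -
    have "K \<le> j" using that by (simp add: K_def Lambda_order_le_iff)
    then obtain i where i: "j = K + i" by (metis le_Suc_ex)
    define C where "C = fact i * 2 powr (real j - \<beta>)"
    have "norm ((deriv ^^ j) f z) \<le> C * A * Omega j \<beta> (norm z)"
      if "0 \<le> A" "Lambda_bound \<beta> f A" and z: "z \<in> unit_disk" for f A z
    proof -
      have f: "f holomorphic_on unit_disk" using that by (simp add: Lambda_bound_def)
      have "norm ((deriv ^^ i) ((deriv ^^ K) f) z)
        \<le> fact i * 2 powr ((real K - \<beta>) + real i) * A * (1 - norm z) powr (- (real K - \<beta>) - real i)"
        using that K by (intro Cauchy_growth_estimate holomorphic_higher_deriv[OF f])
          (auto simp: Lambda_bound_def K_def)
      moreover have "(deriv ^^ j) f z = (deriv ^^ i) ((deriv ^^ K) f) z"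
        by (simp only: i add.commute[of K i] funpow_add o_apply)
      moreover have "(real K - \<beta>) + real i = real j - \<beta>" "- (real K - \<beta>) - real i = \<beta> - real j"
        by (simp_all add: i)
      ultimately have "norm ((deriv ^^ j) f z) \<le> fact i * 2 powr (real j - \<beta>) * A * (1 - norm z) powr (\<beta> - real j)"
        by (simp only:)
      then show ?thesis using z \<open>\<beta> < real j\<close>
        by (simp add: C_def Omega_eq mult_ac)
    qed
    then show ?thesis by (intro exI[of _ C]) (auto simp: C_def)
  qed
  show ?thesis
  proof (cases "j \<le> K")
    case True
    then show ?thesis
    \<comment> \<open>The induction descends from K, where the Cauchy estimate applies, integrating
      at most once per step.\<close>
    proof (induction rule: inc_induct)
      case base
      show ?case by (rule high[OF K])
    next
      case (step j)
      consider "\<beta> < real j" | "real j = \<beta>" | "real j < \<beta>" by linarith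
      then show ?case
      proof cases
        case 1
        then show ?thesis by (rule high)
      next
        case 2
        then have Suc: "\<beta> < real (Suc j)" by simp
        from step.IH obtain C where C: "0 \<le> C" "\<And>f A z. 0 \<le> A \<Longrightarrow> Lambda_bound \<beta> f A \<Longrightarrow> z \<in> unit_disk \<Longrightarrow>
            norm ((deriv ^^ Suc j) f z) \<le> C * A * Omega (Suc j) \<beta> (norm z)" by blast
        have "norm ((deriv ^^ j) f z) \<le> (1 + C) * A * Omega j \<beta> (norm z)"
          if A: "0 \<le> A" and fA: "Lambda_bound \<beta> f A" and z: "z \<in> unit_disk" for f A z
        proof -
          have f: "f holomorphic_on unit_disk" using fA by (simp add: Lambda_bound_def)
          \<comment> \<open>At j = \<beta> the next weight is \<open>(1 - t) powr (-1)\<close>,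
            whose integral is the logarithm; the value at 0 is bounded by \<open>A\<close> because j
            < K.\<close>
          have "norm ((deriv ^^ j) f z) \<le> norm ((deriv ^^ j) f 0) - (C * A) * ln (1 - norm z)"
            using C(2)[OF A fA] 2 by (intro growth_integral_log holomorphic_higher_deriv[OF f] z)
               (auto simp: Omega_eq)
          also have "norm ((deriv ^^ j) f 0) \<le> A"
            using fA step.hyps by (simp add: Lambda_bound_def K_def)
          also have "A - C * A * ln (1 - norm z) \<le> (1 + C) * A * (1 - ln (1 - norm z))"
          proof -
            have "0 \<le> A * - ln (1 - norm z)"
              using A z by (intro mult_nonneg_nonneg) auto
            moreover have "0 \<le> C * A" using A C by simp
            ultimately show ?thesis by (simp add: algebra_simps)
          qed
          finally show ?thesis using 2 z by (simp add: Omega_eq)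
        qed
        then show ?thesis using C(1) by (intro exI[of _ "1 + C"]) auto
      next
        case 3
        from Omega_Suc_le[OF 3] obtain \<delta> where \<delta>: "0 < \<delta>"
          "\<And>t. 0 \<le> t \<Longrightarrow> t < 1 \<Longrightarrow> Omega (Suc j) \<beta> t \<le> 2 * (1 - t) powr (\<delta> - 1)" by blast
        from step.IH obtain C where C: "0 \<le> C" "\<And>f A z. 0 \<le> A \<Longrightarrow> Lambda_bound \<beta> f A \<Longrightarrow> z \<in> unit_disk \<Longrightarrow>
            norm ((deriv ^^ Suc j) f z) \<le> C * A * Omega (Suc j) \<beta> (norm z)" by blast
        have "norm ((deriv ^^ j) f z) \<le> (1 + C * 2 / \<delta>) * A * Omega j \<beta> (norm z)"
          if A: "0 \<le> A" and fA: "Lambda_bound \<beta> f A" and z: "z \<in> unit_disk" for f A z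
        proof -
          have f: "f holomorphic_on unit_disk" using fA by (simp add: Lambda_bound_def)
          have "norm ((deriv ^^ Suc j) f w) \<le> C * A * 2 * (1 - norm w) powr (\<delta> - 1)"
            if "w \<in> unit_disk" for w
          proof -
            have "norm ((deriv ^^ Suc j) f w) \<le> C * A * Omega (Suc j) \<beta> (norm w)"
              using C(2) A fA that by blast
            also have "\<dots> \<le> C * A * (2 * (1 - norm w) powr (\<delta> - 1))"
              using that A C(1) by (intro mult_left_mono \<delta>(2)) auto
            finally show ?thesis by simp
          qed
          \<comment> \<open>Taking s = \<open>- \<delta>\<close> turns the bracket into
            \<open>(1 - u powr \<delta>) / \<delta>\<close> with u = 1 - |z|, which is at most
            \<open>1 / \<delta>\<close>.\<close>
          then have "norm ((deriv ^^ j) f z) \<le> norm ((deriv ^^ j) f 0) +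
              (C * A * 2) * (((1 - norm z) powr (- (- \<delta>)) - 1) / (- \<delta>))"
            using \<delta>(1) by (intro growth_integral_power holomorphic_higher_deriv[OF f] z) auto
          also have "norm ((deriv ^^ j) f 0) \<le> A"
            using fA step.hyps by (simp add: Lambda_bound_def K_def)
          also have "((1 - norm z) powr (- (- \<delta>)) - 1) / (- \<delta>) \<le> 1 / \<delta>"
            using \<delta>(1) by (simp add: field_simps)
          finally have "norm ((deriv ^^ j) f z) \<le> A + (C * A * 2) * (1 / \<delta>)"
            using A C(1) by (simp add: mult_left_mono)
          then show ?thesis using 3 z by (simp add: Omega_eq algebra_simps)
        qed
        then show ?thesis using C(1) \<delta>(1) by (intro exI[of _ "1 + C * 2 / \<delta>"]) auto
      qed
    qed
  next
    case False
    then show ?thesis using K by (intro high) auto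
  qed
qed

text \<open>Lets the J-th derivative stand in for the one of smallest order. Each radial integration
  lowers the order by one; as k > \<alpha> all the way down to \<open>Lambda_order \<alpha>\<close>,
  only pure powers occur and no logarithm.\<close>

lemma Lambda_bound_of_higher_deriv:
  assumes "\<alpha> < real J"
  shows "\<exists>C\<ge>0. \<forall>f A. 0 \<le> A \<longrightarrow> f holomorphic_on unit_disk \<longrightarrow> (\<forall>i<J. norm ((deriv ^^ i) f 0) \<le> A) \<longrightarrow>
     (\<forall>z\<in>unit_disk. norm ((deriv ^^ J) f z) \<le> A * (1 - norm z) powr (\<alpha> - real J)) \<longrightarrow>
     Lambda_bound \<alpha> f (C * A)"
proof -
  define K where "K = Lambda_order \<alpha>"
  have K: "\<alpha> < real K" unfolding K_def using Lambda_order_le_iff by blast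
  have "K \<le> J" using assms by (simp add: K_def Lambda_order_le_iff)
  define P where "P k C \<longleftrightarrow> (\<forall>f A. 0 \<le> A \<longrightarrow> f holomorphic_on unit_disk \<longrightarrow> (\<forall>i<J. norm ((deriv ^^ i) f 0) \<le> A) \<longrightarrow>
     (\<forall>z\<in>unit_disk. norm ((deriv ^^ J) f z) \<le> A * (1 - norm z) powr (\<alpha> - real J)) \<longrightarrow>
     (\<forall>z\<in>unit_disk. norm ((deriv ^^ k) f z) \<le> C * A * (1 - norm z) powr (\<alpha> - real k)))" for k and C :: real
  have "\<exists>C\<ge>0. P K C"
    using \<open>K \<le> J\<close>
  proof (induction rule: inc_induct)
    case base
    show ?case by (rule exI[of _ 1]) (simp add: P_def)
  next
    case (step k)
    then obtain C where C: "0 \<le> C" "P (Suc k) C" by blast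
    define s where "s = real k - \<alpha>"
    have s: "0 < s" using K step.hyps by (simp add: s_def)
    have "norm ((deriv ^^ k) f z) \<le> (1 + C / s) * A * (1 - norm z) powr (\<alpha> - real k)"
      if A: "0 \<le> A" and f: "f holomorphic_on unit_disk" and 0: "\<forall>i<J. norm ((deriv ^^ i) f 0) \<le> A"
        and bd: "\<forall>z\<in>unit_disk. norm ((deriv ^^ J) f z) \<le> A * (1 - norm z) powr (\<alpha> - real J)"
        and z: "z \<in> unit_disk" for f A z
    proof -
      have "norm ((deriv ^^ Suc k) f w) \<le> C * A * (1 - norm w) powr (\<alpha> - real (Suc k))"
        if "w \<in> unit_disk" for w
        using C(2) A f 0 bd that unfolding P_def by blast
      then have "norm ((deriv ^^ k) f z) \<le> norm ((deriv ^^ k) f 0) +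
          (C * A) * (((1 - norm z) powr (- s) - 1) / s)"
        using s by (intro growth_integral_power holomorphic_higher_deriv[OF f] z) (auto simp: s_def algebra_simps)
      also have "norm ((deriv ^^ k) f 0) \<le> A" using 0 step.hyps by simp
      also have "((1 - norm z) powr (- s) - 1) / s \<le> (1 - norm z) powr (- s) / s"
        using s by (simp add: divide_right_mono)
      finally have "norm ((deriv ^^ k) f z) \<le> A * 1 + (C * A) * ((1 - norm z) powr (- s) / s)"
        using A C(1) by (simp add: mult_left_mono)
      \<comment> \<open>The initial value is absorbed into the weight, which is at least 1 since its
        exponent is negative.\<close>
      also have "\<dots> \<le> A * (1 - norm z) powr (- s) + (C * A) * ((1 - norm z) powr (- s) / s)"
        using A s z powr_mono'[of "- s" 0 "1 - norm z"] by (intro add_right_mono mult_left_mono) auto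
      also have "\<dots> = (1 + C / s) * A * (1 - norm z) powr (\<alpha> - real k)"
        by (simp add: s_def algebra_simps)
      finally show ?thesis .
    qed
    then show ?case using C(1) s by (intro exI[of _ "1 + C / s"]) (auto simp: P_def)
  qed
  then obtain C where C: "0 \<le> C" "P K C" by blast
  have "Lambda_bound \<alpha> f ((1 + C) * A)"
    if A: "0 \<le> A" and f: "f holomorphic_on unit_disk" and 0: "\<forall>i<J. norm ((deriv ^^ i) f 0) \<le> A"
        and bd: "\<forall>z\<in>unit_disk. norm ((deriv ^^ J) f z) \<le> A * (1 - norm z) powr (\<alpha> - real J)" for f A
  proof -
    have le: "A \<le> (1 + C) * A" "C * A \<le> (1 + C) * A"
      using A C(1) by (simp_all add: algebra_simps)
    have "norm ((deriv ^^ j) f 0) \<le> (1 + C) * A" if "j < Lambda_order \<alpha>" for j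
      using 0 that \<open>K \<le> J\<close> order_trans[OF _ le(1)] by (simp add: K_def)
    moreover have "norm ((deriv ^^ K) f z) \<le> (1 + C) * A * (1 - norm z) powr (\<alpha> - real K)"
      if "z \<in> unit_disk" for z
    proof -
      have "norm ((deriv ^^ K) f z) \<le> C * A * (1 - norm z) powr (\<alpha> - real K)"
        using C(2) A f 0 bd that unfolding P_def by blast
      also have "\<dots> \<le> (1 + C) * A * (1 - norm z) powr (\<alpha> - real K)"
        by (rule mult_right_mono[OF le(2)]) simp
      finally show ?thesis .
    qed
    ultimately show ?thesis using f unfolding Lambda_bound_def K_def by blast
  qed
  then show ?thesis using C(1) by (intro exI[of _ "1 + C"]) auto
qed

section \<open>Test functions\<close>

text \<open>In the Leibniz sum only the j-th derivative of \<open>(z - w) ^ j\<close> survives at w,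
  and i \<le> j leaves it only for i = j. This isolates one coefficient in the necessity
  part.\<close>

lemma higher_deriv_zero_factor:
  assumes h: "h holomorphic_on unit_disk" and w: "w \<in> unit_disk" and i: "i \<le> j"
  shows "(deriv ^^ i) (\<lambda>z. (z - w) ^ j * h z) w = (if i = j then fact j * h w else 0)"
proof -
  have d: "(deriv ^^ k) (\<lambda>z. (z - w) ^ j) w = (if k = j then fact j else 0)" for k
    by (cases k j rule: linorder_cases)
       (simp_all add: higher_deriv_power pochhammer_fact pochhammer_0_left)
  have "(deriv ^^ i) (\<lambda>z. (z - w) ^ j * h z) w
    = (\<Sum>k = 0..i. of_nat (i choose k) * (deriv ^^ k) (\<lambda>z. (z - w) ^ j) w * (deriv ^^ (i - k)) h w)"
    by (rule higher_deriv_mult[OF _ h open_ball w]) (intro holomorphic_intros)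
  also have "\<dots> = (\<Sum>k = 0..i. if k = j then of_nat (i choose j) * fact j * (deriv ^^ (i - j)) h w else 0)"
    by (intro sum.cong refl) (simp add: d)
  also have "\<dots> = (if i = j then fact j * h w else 0)"
    using i by auto
  finally show ?thesis .
qed

text \<open>The pseudohyperbolic distance is at most 1, because |1 - cnj w z|^2 - |z - w|^2 = (1 -
  |w|^2)(1 - |z|^2).\<close>

lemma norm_diff_le_norm_one_minus:
  assumes "norm w \<le> 1" "norm z \<le> 1"
  shows "norm (z - w) \<le> norm (1 - cnj w * z)"
proof -
  have "(norm (1 - cnj w * z))\<^sup>2 - (norm (z - w))\<^sup>2 = (1 - (norm w)\<^sup>2) * (1 - (norm z)\<^sup>2)"
    unfolding cmod_power2 by (simp add: power2_eq_square algebra_simps)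
  moreover have "0 \<le> (1 - (norm w)\<^sup>2) * (1 - (norm z)\<^sup>2)"
    using assms by (intro mult_nonneg_nonneg) (auto simp: power_le_one)
  ultimately have "(norm (z - w))\<^sup>2 \<le> (norm (1 - cnj w * z))\<^sup>2" by linarith
  then show ?thesis by (rule power2_le_imp_le) simp
qed

text \<open>The radius is adapted to the kernel 1 - cnj w x, so that every factor of a test function
  lives on the scale r near z. The disc may leave the unit disk, which is why x is
  unrestricted.\<close>

lemma kernel_disc_bounds:
  assumes w: "w \<in> unit_disk" and z: "z \<in> unit_disk"
  defines "r \<equiv> norm (1 - cnj w * z) / 2"
  shows "0 < r" "1 - norm z \<le> 2 * r" "1 - norm w \<le> 2 * r"
    and "\<And>x. norm (z - x) \<le> r \<Longrightarrow> r \<le> norm (1 - cnj w * x)"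
    and "\<And>x. norm (z - x) \<le> r \<Longrightarrow> norm (x - w) \<le> 3 * r"
proof -
  have "1 - norm w * norm z \<le> 2 * r"
    using norm_triangle_ineq2[of 1 "cnj w * z"] by (simp add: r_def norm_mult)
  moreover have "norm w * norm z \<le> norm z" "norm w * norm z \<le> norm w"
    using w z by (auto intro: mult_left_le_one_le mult_right_le_one_le)
  ultimately show le: "1 - norm z \<le> 2 * r" "1 - norm w \<le> 2 * r" by linarith+
  with z show "0 < r" by simp
  fix x assume x: "norm (z - x) \<le> r"
  have "norm (cnj w * (z - x)) \<le> 1 * r"
    unfolding norm_mult by (rule mult_mono) (use w x in auto)
  moreover have "(1 - cnj w * z) - - (cnj w * (z - x)) = 1 - cnj w * x" by (simp add: algebra_simps)
  then have "norm (1 - cnj w * z) - norm (cnj w * (z - x)) \<le> norm (1 - cnj w * x)"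
    using norm_triangle_ineq2[of "1 - cnj w * z" "- (cnj w * (z - x))"] by (simp only: norm_minus_cancel)
  ultimately show "r \<le> norm (1 - cnj w * x)"
    by (simp add: r_def)
  have "norm (z - w) \<le> 2 * r"
    using norm_diff_le_norm_one_minus[of w z] w z by (simp add: r_def)
  then show "norm (x - w) \<le> 3 * r"
    using x norm_triangle_ineq[of "x - z" "z - w"] by (simp add: norm_minus_commute)
qed

text \<open>The weight is constant here, so the plain power \<open>(z - w) ^ j\<close>
  suffices.\<close>

lemma test_function_below:
  assumes "real j < \<beta>"
  shows "\<exists>C\<ge>0. \<exists>c>0. \<forall>w\<in>unit_disk. \<exists>f. Lambda_bound \<beta> f C \<and> (\<forall>i<j. (deriv ^^ i) f w = 0) \<and>
    c * Omega j \<beta> (norm w) \<le> norm ((deriv ^^ j) f w)"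
proof -
  define K where "K = Lambda_order \<beta>"
  have K: "\<beta> < real K" unfolding K_def using Lambda_order_le_iff by blast
  define C :: real where "C = fact K * 3 ^ j"
  \<comment> \<open>The factor 1 plays the part of \<open>h\<close> in
    \<open>higher_deriv_zero_factor\<close>.\<close>
  have "Lambda_bound \<beta> (\<lambda>z. (z - w) ^ j * 1) C \<and> (\<forall>i<j. (deriv ^^ i) (\<lambda>z. (z - w) ^ j * 1) w = 0) \<and>
    1 * Omega j \<beta> (norm w) \<le> norm ((deriv ^^ j) (\<lambda>z. (z - w) ^ j * 1) w)"
    if w: "w \<in> unit_disk" for w
  proof (intro conjI allI impI)
    let ?f = "\<lambda>z. (z - w) ^ j * 1"
    have bd: "norm ((deriv ^^ i) ?f z) \<le> C" if z: "z \<in> unit_disk" and i: "i \<le> K" for i z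
    proof -
      \<comment> \<open>The polynomial is entire, so the circle of radius 1 about z is allowed; on
        it |x - w| \<le> 1 + |z| + |w| \<le> 3.\<close>
      have "norm ((deriv ^^ i) ?f z) \<le> fact i * 3 ^ j / 1 ^ i"
      proof (rule Cauchy_inequality)
        show "norm (?f x) \<le> 3 ^ j" if "norm (z - x) = 1" for x
        proof -
          have "norm (x - w) \<le> 3"
            using that w z norm_triangle_ineq[of "x - z" "z - w"] norm_triangle_ineq4[of z w]
            by (simp add: norm_minus_commute)
          then show ?thesis by (simp add: norm_power power_mono)
        qed
      qed (auto intro!: holomorphic_intros continuous_intros)
      also have "\<dots> \<le> C" using i by (simp add: C_def fact_mono)
      finally show ?thesis .
    qed
    have "C \<le> C * (1 - norm z) powr (\<beta> - real K)" if "z \<in> unit_disk" for z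
    proof -
      have "1 \<le> (1 - norm z) powr (\<beta> - real K)"
        using that K powr_mono'[of "\<beta> - real K" 0 "1 - norm z"] by simp
      then have "C * 1 \<le> C * (1 - norm z) powr (\<beta> - real K)"
        by (rule mult_left_mono) (simp add: C_def)
      then show ?thesis by simp
    qed
    with bd show "Lambda_bound \<beta> ?f C"
      unfolding Lambda_bound_def K_def[symmetric]
      by (force intro!: holomorphic_intros intro: order_trans)
    show "(deriv ^^ i) ?f w = 0" if "i < j" for i
      using that by (subst higher_deriv_zero_factor[OF _ w]) auto
    show "1 * Omega j \<beta> (norm w) \<le> norm ((deriv ^^ j) ?f w)"
      by (subst higher_deriv_zero_factor[OF _ w])
         (use w assms in \<open>auto simp: Omega_eq norm_mult\<close>)
  qed
  then show ?thesis
    by (intro exI[of _ C] exI[of _ "1::real"] conjI ballI) (auto simp: C_def simp del: mult_1_right)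
qed

section \<open>Test functions built from the kernel 1 - cnj w z\<close>

lemma one_minus_cnj_self: "1 - cnj w * w = of_real (1 - (norm w)\<^sup>2)"
proof -
  have "cnj w * w = of_real ((norm w)\<^sup>2)" by (metis complex_norm_square mult.commute)
  then show ?thesis by (simp only: of_real_diff of_real_1)
qed

text \<open>Keeps the kernel away from zero and from the branch cut of \<open>Ln\<close>.\<close>

lemma Re_one_minus_cnj_pos: "0 < Re (1 - cnj w * z)" if "w \<in> unit_disk" "z \<in> unit_disk"
proof -
  have "norm (cnj w * z) < 1"
    using that mult_strict_mono[of "norm w" 1 "norm z" 1] by (simp add: norm_mult)
  then show ?thesis using complex_Re_le_cmod[of "cnj w * z"] by simp
qed

text \<open>The test function is \<open>(z - w) ^ j\<close> times (1 - |w|)^m / (1 - cnj w z)^M. An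
  integer M avoids branches of powers; the exponent m corrects the rounding, so that the degree on
  the scale |1 - cnj w z| is j + m - M = \<beta>.\<close>

lemma test_function_above:
  assumes "\<beta> < real j"
  shows "\<exists>C\<ge>0. \<exists>c>0. \<forall>w\<in>unit_disk. \<exists>f. Lambda_bound \<beta> f C \<and> (\<forall>i<j. (deriv ^^ i) f w = 0) \<and>
    c * Omega j \<beta> (norm w) \<le> norm ((deriv ^^ j) f w)"
proof -
  define K where "K = Lambda_order \<beta>"
  have K: "\<beta> < real K" unfolding K_def using Lambda_order_le_iff by blast
  define M where "M = nat \<lceil>real j - \<beta>\<rceil>"
  define m where "m = real M - (real j - \<beta>)"
  have m: "0 \<le> m" unfolding m_def M_def by linarith
  define D :: real where "D = 2 powr m * 3 ^ j"
  have D: "0 \<le> D" by (simp add: D_def)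
  define C :: real where "C = fact K * D * 2 powr (real K + \<bar>\<beta>\<bar>)"
  define c :: real where "c = 1 / 2 ^ M"
  have "\<exists>f. Lambda_bound \<beta> f C \<and> (\<forall>i<j. (deriv ^^ i) f w = 0) \<and>
    c * Omega j \<beta> (norm w) \<le> norm ((deriv ^^ j) f w)"
    if w: "w \<in> unit_disk" for w
  proof (intro exI conjI allI impI)
    define h where "h z = of_real ((1 - norm w) powr m) / (1 - cnj w * z) ^ M" for z
    define f where "f z = (z - w) ^ j * h z" for z
    have h: "h holomorphic_on unit_disk" unfolding h_def
      using Re_one_minus_cnj_pos[OF w] by (intro holomorphic_intros) fastforce
    then have f: "f holomorphic_on unit_disk" unfolding f_def by (intro holomorphic_intros)
    have bd: "norm ((deriv ^^ i) f z) \<le> fact i * D * (norm (1 - cnj w * z) / 2) powr (\<beta> - real i)"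
      if z: "z \<in> unit_disk" for i z
    proof -
      define r where "r = norm (1 - cnj w * z) / 2"
      note r = kernel_disc_bounds[OF w z, folded r_def]
      \<comment> \<open>This holds even outside the unit disk, since the kernel is at least r in
        modulus on this disc.\<close>
      have "f holomorphic_on cball z r"
        unfolding f_def h_def using r(1,4) by (intro holomorphic_intros) (force simp: dist_norm)
      then have "norm ((deriv ^^ i) f z) \<le> fact i * ((3 * r) ^ j * ((2 * r) powr m / r ^ M)) / r ^ i"
      proof (intro Cauchy_inequality holomorphic_on_imp_continuous_on)
        show "f holomorphic_on ball z r" if "f holomorphic_on cball z r"
          using that by (rule holomorphic_on_subset) auto
        show "norm (f x) \<le> (3 * r) ^ j * ((2 * r) powr m / r ^ M)" if "norm (z - x) = r" for x
        proof -
          have "norm (f x) = norm (x - w) ^ j * ((1 - norm w) powr m / norm (1 - cnj w * x) ^ M)"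
            using w by (simp add: f_def h_def norm_mult norm_divide norm_power)
          also have "\<dots> \<le> (3 * r) ^ j * ((2 * r) powr m / r ^ M)"
            using r(1,3) r(4,5)[of x] that m w
            by (intro mult_mono power_mono frac_le powr_mono2 zero_less_power) auto
          finally show ?thesis .
        qed
      qed (use r(1) in auto)
      also have "\<dots> = fact i * D * (r powr real j * r powr m / r powr real M / r powr real i)"
        using r(1) by (simp add: D_def powr_mult power_mult_distrib powr_realpow)
      also have "r powr real j * r powr m / r powr real M / r powr real i = r powr (\<beta> - real i)"
        by (simp add: m_def powr_add[symmetric] powr_diff[symmetric])
      finally show ?thesis by (simp add: r_def)
    qed
    \<comment> \<open>One power of 2 for all orders i \<le> K; the absolute value covers both signs
      of \<beta>.\<close>
    have pw: "2 powr (real i - \<beta>) \<le> 2 powr (real K + \<bar>\<beta>\<bar>)" if "i \<le> K" for i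
      using that by (intro powr_mono) auto
    have half: "(x / 2) powr (\<beta> - real i) = 2 powr (real i - \<beta>) * x powr (\<beta> - real i)" if "0 < x" for x :: real and i
      using that by (simp add: powr_divide powr_diff field_simps)
    have "norm ((deriv ^^ i) f 0) \<le> C" if "i < K" for i
    proof -
      have "norm ((deriv ^^ i) f 0) \<le> fact i * D * 2 powr (real i - \<beta>)"
        using bd[of 0 i] half[of 1 i] by simp
      also have "\<dots> \<le> C" unfolding C_def
        using that D by (intro mult_mono pw fact_mono) auto
      finally show ?thesis .
    qed
    moreover have "norm ((deriv ^^ K) f z) \<le> C * (1 - norm z) powr (\<beta> - real K)" if z: "z \<in> unit_disk" for z
    proof -
      note r = kernel_disc_bounds[OF w z]
      have "norm ((deriv ^^ K) f z) \<le> fact K * D * (norm (1 - cnj w * z) / 2) powr (\<beta> - real K)"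
        by (rule bd[OF z])
      \<comment> \<open>As \<beta> - K is negative, the kernel may be replaced by its lower bound 1
        - |z|.\<close>
      also have "\<dots> \<le> fact K * D * ((1 - norm z) / 2) powr (\<beta> - real K)"
        using D K z r(2) by (intro mult_left_mono powr_mono2') auto
      also have "\<dots> = (fact K * D * 2 powr (real K - \<beta>)) * (1 - norm z) powr (\<beta> - real K)"
        using z by (simp add: half)
      also have "\<dots> \<le> C * (1 - norm z) powr (\<beta> - real K)" unfolding C_def
        using D by (intro mult_right_mono mult_left_mono pw) auto
      finally show ?thesis .
    qed
    ultimately show "Lambda_bound \<beta> f C"
      unfolding Lambda_bound_def K_def[symmetric] using f by blast
    show "(deriv ^^ i) f w = 0" if "i < j" for i
      unfolding f_def using that by (subst higher_deriv_zero_factor[OF h w]) auto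
    show "c * Omega j \<beta> (norm w) \<le> norm ((deriv ^^ j) f w)"
    proof -
      define u where "u = 1 - norm w"
      have u: "0 < u" using w by (simp add: u_def)
      \<comment> \<open>At z = w the kernel is 1 - |w|^2, at most twice 1 - |w|; the constant
        \<open>c\<close> pays for the M-th power of this 2.\<close>
      have v: "0 < 1 - (norm w)\<^sup>2" "1 - (norm w)\<^sup>2 \<le> 2 * u"
        using w power_less_one_iff[of "norm w" 2] zero_le_power2[of "1 - norm w"]
        by (auto simp: u_def power2_eq_square algebra_simps)
      have "c * Omega j \<beta> (norm w) = u powr m / (2 * u) ^ M"
      proof -
        have "Omega j \<beta> (norm w) = u powr (m - real M)"
          using w assms by (simp add: Omega_eq m_def u_def)
        then show ?thesis
          using u by (simp add: c_def powr_diff powr_realpow power_mult_distrib)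
      qed
      also have "\<dots> \<le> u powr m / (1 - (norm w)\<^sup>2) ^ M"
        using u v by (intro divide_left_mono power_mono mult_pos_pos zero_less_power) auto
      also have "\<dots> = norm (h w)"
        using v by (simp add: h_def one_minus_cnj_self u_def norm_divide norm_power del: of_real_diff)
      also have "\<dots> \<le> fact j * norm (h w)"
        using mult_right_mono[OF fact_ge_1, of "norm (h w)" j] by simp
      also have "\<dots> = norm ((deriv ^^ j) f w)"
        unfolding f_def using higher_deriv_zero_factor[OF h w order_refl, of j] by (simp add: norm_mult)
      finally show ?thesis .
    qed
  qed
  then show ?thesis
    using D by (intro exI[of _ C] exI[of _ c] conjI ballI) (auto simp: C_def c_def)
qed

text \<open>In the right half plane both arguments are below pi/2 in modulus, so their difference
  stays on the principal branch.\<close>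

lemma Ln_divide_Re_pos:
  assumes "0 < Re a" "0 < Re b"
  shows "Ln (a / b) = Ln a - Ln b"
proof (rule Ln_unique)
  have "a \<noteq> 0" "b \<noteq> 0" using assms by auto
  then show "exp (Ln a - Ln b) = a / b" by (simp add: exp_diff)
  show "- pi < Im (Ln a - Ln b)" "Im (Ln a - Ln b) \<le> pi"
    using Re_Ln_pos_lt_imp[OF assms(1)] Re_Ln_pos_lt_imp[OF assms(2)] by auto
qed

text \<open>In the critical case h(z) = 1 - Ln(1 - cnj w z) replaces the power of the kernel; its
  value at w is 1 - ln(1 - |w|^2), comparable with the logarithmic weight.\<close>

lemma test_function_eq:
  assumes "\<beta> = real j"
  shows "\<exists>C\<ge>0. \<exists>c>0. \<forall>w\<in>unit_disk. \<exists>f. Lambda_bound \<beta> f C \<and> (\<forall>i<j. (deriv ^^ i) f w = 0) \<and>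
    c * Omega j \<beta> (norm w) \<le> norm ((deriv ^^ j) f w)"
proof -
  \<comment> \<open>The order exceeds \<beta> strictly, so one derivative more than the degree of
    the zero factor must be controlled.\<close>
  have K: "Lambda_order \<beta> = Suc j"
    using Lambda_order_le_iff[of \<beta> "Suc j"] Lambda_order_le_iff[of \<beta> j] assms by auto
  define C :: real where "C = fact (Suc j) * 6 ^ j * 2"
  \<comment> \<open>Passing from ln(1 - t) to ln(1 - t^2) loses at most ln 2, which is less than the
    constant term 1 of the weight.\<close>
  define c :: real where "c = 1 - ln 2"
  have c: "0 < c" "c \<le> 1" using ln_add_one_self_less_self[of 1] by (auto simp: c_def)
  have "\<exists>f. Lambda_bound \<beta> f C \<and> (\<forall>i<j. (deriv ^^ i) f w = 0) \<and>
    c * Omega j \<beta> (norm w) \<le> norm ((deriv ^^ j) f w)"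
    if w: "w \<in> unit_disk" for w
  proof (intro exI conjI allI impI)
    define h where "h z = 1 - Ln (1 - cnj w * z)" for z
    define f where "f z = (z - w) ^ j * h z" for z
    note pos = Re_one_minus_cnj_pos[OF w]
    have h: "h holomorphic_on unit_disk" unfolding h_def
      using pos by (intro holomorphic_intros) (auto simp: complex_nonpos_Reals_iff not_le)
    then have f: "f holomorphic_on unit_disk" unfolding f_def by (intro holomorphic_intros)
    have "norm ((deriv ^^ i) f 0) \<le> C" if i: "i < Suc j" for i
    proof -
      \<comment> \<open>On the circle |x| = 1/2 the logarithm has modulus at most 1, uniformly in
        w.\<close>
      have sub: "cball 0 (1/2) \<subseteq> unit_disk" by (auto simp: dist_norm)
      have "norm ((deriv ^^ i) f 0) \<le> fact i * (2 ^ j * 2) / (1/2) ^ i"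
      proof (rule Cauchy_inequality)
        show "f holomorphic_on ball 0 (1/2)" using f by (rule holomorphic_on_subset) auto
        show "continuous_on (cball 0 (1/2)) f"
          using holomorphic_on_subset[OF f sub] by (rule holomorphic_on_imp_continuous_on)
        show "norm (f x) \<le> 2 ^ j * 2" if x: "norm (0 - x) = 1/2" for x
        proof -
          have nx: "norm x = 1/2" using x by simp
          have "norm (- (cnj w * x)) = norm w * (1/2)"
            by (simp only: norm_minus_cancel norm_mult complex_mod_cnj nx)
          then have "norm (- (cnj w * x)) < 1/2" using w by simp
          from norm_Ln_le[OF this] have "norm (Ln (1 - cnj w * x)) \<le> 1"
            using \<open>norm (- (cnj w * x)) < 1/2\<close> by simp
          then have "norm (h x) \<le> 2"
            unfolding h_def using norm_triangle_ineq4[of 1 "Ln (1 - cnj w * x)"] by simp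
          moreover have "norm (x - w) \<le> 2"
            using w x norm_triangle_ineq4[of x w] by simp
          ultimately show ?thesis
            unfolding f_def norm_mult norm_power by (intro mult_mono power_mono) auto
        qed
      qed simp
      also have "\<dots> = fact i * (2 ^ j * 2 ^ i) * 2" by (simp add: power_divide)
      also have "\<dots> \<le> fact (Suc j) * (2 ^ j * 2 ^ j) * 2"
        using i by (intro mult_mono fact_mono power_increasing) auto
      also have "(2::real) ^ j * 2 ^ j \<le> 6 ^ j"
        unfolding power_mult_distrib[symmetric] by (intro power_mono) auto
      finally show ?thesis by (simp add: C_def)
    qed
    moreover have "norm ((deriv ^^ Suc j) f z) \<le> C * (1 - norm z) powr (\<beta> - real (Suc j))"
      if z: "z \<in> unit_disk" for z
    proof -
      define b where "b = 1 - cnj w * z"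
      define r where "r = norm b / 2"
      note r = kernel_disc_bounds[OF w z, folded b_def, folded r_def]
      have b0: "b \<noteq> 0" using r(1) by (auto simp: r_def)
      define q where "q x = cnj w * (z - x) / b" for x
      \<comment> \<open>Only the oscillation of the logarithm near \<open>z\<close> matters, because \<open>(x - w) ^ j\<close> is killed by \<open>Suc j\<close> derivatives.\<close>
      define k where "k x = (x - w) ^ j * Ln (1 + q x)" for x
      have q: "norm (q x) < 1/2" if "norm (z - x) \<le> r" for x
      proof -
        have "norm (q x) \<le> norm w * r / norm b"
          using that by (simp add: q_def norm_mult norm_divide divide_right_mono mult_left_mono)
        also have "\<dots> = norm w / 2" using b0 by (simp add: r_def)
        finally show ?thesis using w by simp
      qed
      have k: "k holomorphic_on cball z r"
      proof -
        have "1 + q x \<notin> \<real>\<^sub>\<le>\<^sub>0" if "x \<in> cball z r" for x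
          using q[of x] that abs_Re_le_cmod[of "q x"] by (auto simp: complex_nonpos_Reals_iff dist_norm)
        moreover have "q holomorphic_on cball z r"
          unfolding q_def using b0 by (intro holomorphic_intros) auto
        ultimately show ?thesis
          unfolding k_def by (intro holomorphic_intros) auto
      qed
      have "norm ((deriv ^^ Suc j) k z) \<le> fact (Suc j) * ((3 * r) ^ j * 1) / r ^ Suc j"
      proof (intro Cauchy_inequality holomorphic_on_imp_continuous_on[OF k])
        show "k holomorphic_on ball z r" using k by (rule holomorphic_on_subset) auto
        show "norm (k x) \<le> (3 * r) ^ j * 1" if x: "norm (z - x) = r" for x
        proof -
          have "norm (Ln (1 + q x)) \<le> 1" using norm_Ln_le[of "q x"] q[of x] x by linarith
          then show ?thesis unfolding k_def norm_mult norm_power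
            using r(1) r(5)[of x] x by (intro mult_mono power_mono) auto
        qed
      qed (use r(1) in auto)
      also have "\<dots> = fact (Suc j) * 3 ^ j / r"
        using r(1) by (simp add: power_mult_distrib)
      also have "\<dots> \<le> fact (Suc j) * 3 ^ j / ((1 - norm z) / 2)"
        using r(1,2) z by (intro divide_left_mono) auto
      also have "\<dots> = fact (Suc j) * 3 ^ j * 2 * (1 - norm z) powr (- 1)"
        using z by (simp add: powr_minus field_simps)
      also have "\<dots> \<le> C * (1 - norm z) powr (\<beta> - real (Suc j))"
        unfolding C_def using assms by (intro mult_mono power_mono) auto
      finally have kb: "norm ((deriv ^^ Suc j) k z) \<le> C * (1 - norm z) powr (\<beta> - real (Suc j))" .
      \<comment> \<open>The logarithm identity is used for x in the unit disk, which
        \<open>ball z r\<close> may leave.\<close>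
      define S where "S = ball z r \<inter> unit_disk"
      have S: "open S" "z \<in> S" using r(1) z by (auto simp: S_def)
      have kS: "k holomorphic_on S" using k by (rule holomorphic_on_subset) (auto simp: S_def)
      have "(deriv ^^ Suc j) f z = (deriv ^^ Suc j) (\<lambda>x. (1 - Ln b) * (x - w) ^ j - k x) z"
      proof (rule higher_deriv_transform_within_open[OF _ _ S])
        show "f holomorphic_on S" using f by (rule holomorphic_on_subset) (auto simp: S_def)
        show "(\<lambda>x. (1 - Ln b) * (x - w) ^ j - k x) holomorphic_on S"
          by (intro holomorphic_intros kS)
        fix x assume "x \<in> S"
        then have x: "x \<in> unit_disk" by (simp add: S_def)
        have "1 + q x = (1 - cnj w * x) / b"
          using b0 by (simp add: q_def field_simps) (simp add: b_def algebra_simps)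
        then have Lq: "Ln (1 + q x) = Ln (1 - cnj w * x) - Ln b"
          using Ln_divide_Re_pos[OF pos[OF x] pos[OF z]] by (simp add: b_def)
        show "f x = (1 - Ln b) * (x - w) ^ j - k x"
          unfolding f_def h_def k_def Lq by (simp add: algebra_simps)
      qed
      also have "\<dots> = (deriv ^^ Suc j) (\<lambda>x. (1 - Ln b) * (x - w) ^ j) z - (deriv ^^ Suc j) k z"
        by (rule higher_deriv_diff[OF _ kS S]) (intro holomorphic_intros)
      also have "(deriv ^^ Suc j) (\<lambda>x. (1 - Ln b) * (x - w) ^ j) z = (1 - Ln b) * (deriv ^^ Suc j) (\<lambda>x. (x - w) ^ j) z"
        by (rule higher_deriv_cmult[OF _ S(2,1)]) (intro holomorphic_intros)
      \<comment> \<open>The factor \<open>1 - Ln b\<close>, which has no uniform bound, multiplies a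
        polynomial of degree j and so drops out.\<close>
      also have "(deriv ^^ Suc j) (\<lambda>x. (x - w) ^ j) z = 0"
        unfolding higher_deriv_power by (simp add: pochhammer_0_left)
      finally show ?thesis using kb by simp
    qed
    ultimately show "Lambda_bound \<beta> f C"
      unfolding Lambda_bound_def K using f by blast
    show "(deriv ^^ i) f w = 0" if "i < j" for i
      unfolding f_def using that by (subst higher_deriv_zero_factor[OF h w]) auto
    show "c * Omega j \<beta> (norm w) \<le> norm ((deriv ^^ j) f w)"
    proof -
      define t where "t = norm w"
      have t: "0 \<le> t" "t < 1" using w by (auto simp: t_def)
      have v: "0 < 1 - t\<^sup>2" using t power_less_one_iff[of t 2] by simp
      have "1 - t\<^sup>2 = (1 - t) * (1 + t)" by (simp add: power2_eq_square algebra_simps)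
      then have "ln (1 - t\<^sup>2) = ln (1 - t) + ln (1 + t)" using t by (simp add: ln_mult)
      moreover have "ln (1 + t) \<le> ln 2" using t by (intro ln_mono) auto
      moreover have "ln (1 - t) \<le> 0" using t by simp
      then have "c * - ln (1 - t) \<le> 1 * - ln (1 - t)" using c by (intro mult_right_mono) auto
      ultimately have "c * (1 - ln (1 - t)) \<le> 1 - ln (1 - t\<^sup>2)" by (simp add: c_def algebra_simps)
      also have "\<dots> = Re (h w)"
        using v by (simp add: h_def one_minus_cnj_self t_def[symmetric] Ln_of_real del: of_real_diff)
      also have "\<dots> \<le> norm (h w)" by (rule complex_Re_le_cmod)
      also have "\<dots> \<le> fact j * norm (h w)"
        using mult_right_mono[OF fact_ge_1, of "norm (h w)" j] by simp
      also have "\<dots> = norm ((deriv ^^ j) f w)"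
        unfolding f_def using higher_deriv_zero_factor[OF h w order_refl, of j] by (simp add: norm_mult)
      finally show ?thesis using t assms by (simp add: Omega_eq t_def)
    qed
  qed
  then show ?thesis
    using c by (intro exI[of _ C] exI[of _ c] conjI ballI) (auto simp: C_def)
qed

lemma test_function:
  "\<exists>C\<ge>0. \<exists>c>0. \<forall>w\<in>unit_disk. \<exists>f. Lambda_bound \<beta> f C \<and> (\<forall>i<j. (deriv ^^ i) f w = 0) \<and>
    c * Omega j \<beta> (norm w) \<le> norm ((deriv ^^ j) f w)"
  using test_function_below test_function_eq test_function_above by (metis linorder_neqE_linordered_idom)

section \<open>Weights and monomials\<close>

text \<open>With n + 1 the integer part of 1/(1 - t) one gets t \<ge> n/(n + 1), and (1 + 1/n)^n
  \<le> e keeps t^n above exp(-1). For t = 0 this gives n = 0.\<close>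

lemma monomial_index:
  fixes t :: real
  assumes "0 \<le> t" "t < 1"
  obtains n :: nat where "real n + 1 \<le> 1 / (1 - t)" "1 / (1 - t) < real n + 2" "exp (- 1) \<le> t ^ n"
proof
  define n where "n = nat \<lfloor>1 / (1 - t)\<rfloor> - 1"
  have "1 \<le> 1 / (1 - t)" using assms by (simp add: field_simps)
  then have "1 \<le> \<lfloor>1 / (1 - t)\<rfloor>" by simp
  then have "int n + 1 = \<lfloor>1 / (1 - t)\<rfloor>" unfolding n_def by linarith
  then have n: "real n + 1 = real_of_int \<lfloor>1 / (1 - t)\<rfloor>" by linarith
  show le: "real n + 1 \<le> 1 / (1 - t)" and "1 / (1 - t) < real n + 2"
    using n by linarith+
  show "exp (- 1) \<le> t ^ n"
  proof (cases "n = 0")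
    case False
    have "1 - t \<le> 1 / (real n + 1)" using le assms by (simp add: field_simps)
    then have "real n / (real n + 1) \<le> t" by (simp add: field_simps)
    then have "real n \<le> t * (real n + 1)" by (simp add: field_simps)
    have t: "0 < t" using \<open>real n / (real n + 1) \<le> t\<close> False by (smt (verit) divide_pos_pos of_nat_0_less_iff neq0_conv)
    have "1 / t \<le> 1 + 1 / real n" using False t \<open>real n \<le> t * (real n + 1)\<close> by (simp add: field_simps)
    also have "\<dots> \<le> exp (1 / real n)" by (rule exp_ge_add_one_self)
    finally have "exp (- (1 / real n)) \<le> t" using t by (simp add: exp_minus field_simps)
    then have "exp (- (1 / real n)) ^ n \<le> t ^ n" by (rule power_mono) simp
    then show ?thesis using False by (simp add: exp_of_nat_mult[symmetric])
  qed simp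
qed

text \<open>From s \<le> exp(-(1 - s)). Replacing n by n + 1 in the exponent costs a factor e and
  yields the scaled variable (n + 1)(1 - s).\<close>

lemma power_le_exp_mult:
  fixes s :: real
  assumes "0 \<le> s" "s < 1"
  shows "s ^ n \<le> exp 1 * exp (- ((real n + 1) * (1 - s)))"
proof -
  have "s \<le> exp (- (1 - s))" using exp_ge_add_one_self[of "- (1 - s)"] by simp
  then have "s ^ n \<le> exp (- (1 - s)) ^ n" using assms by (intro power_mono)
  also have "\<dots> = exp (1 - s) * exp (- ((real n + 1) * (1 - s)))"
    by (simp add: exp_of_nat_mult[symmetric] exp_add[symmetric] algebra_simps)
  also have "\<dots> \<le> exp 1 * exp (- ((real n + 1) * (1 - s)))"
    using assms by (intro mult_right_mono) auto
  finally show ?thesis .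
qed

text \<open>The weight is recovered, up to a constant, from the norms of monomials; the index is \<open>n \<approx> 1 / (1 - t)\<close>.\<close>

lemma Omega_le_monomials_log:
  assumes "real j = \<beta>" and t: "0 \<le> t" "t < 1"
  shows "\<exists>n. 0 < t ^ n \<and> (\<forall>s. 0 \<le> s \<longrightarrow> s < 1 \<longrightarrow> Omega j \<beta> t * s ^ n / Omega j \<beta> s \<le> (2 * exp 2) * t ^ n)"
proof -
  from monomial_index[OF t] obtain n where n: "real n + 1 \<le> 1 / (1 - t)" "1 / (1 - t) < real n + 2" "exp (- 1) \<le> t ^ n" .
  define L where "L = ln (real n + 1)"
  have L: "0 \<le> L" by (simp add: L_def)
  have "- ln (1 - t) = ln (1 / (1 - t))" using t by (simp add: ln_div)
  also have "\<dots> \<le> ln (2 * (real n + 1))" using n t by (intro ln_mono) auto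
  also have "\<dots> = ln 2 + L" by (subst ln_mult) (auto simp: L_def)
  finally have \<Omega>t: "Omega j \<beta> t \<le> 2 * (1 + L)"
    using ln_add_one_self_less_self[of 1] L t assms(1) by (simp add: Omega_eq)
  have "Omega j \<beta> t * s ^ n / Omega j \<beta> s \<le> (2 * exp 2) * t ^ n" if s: "0 \<le> s" "s < 1" for s
  proof -
    \<comment> \<open>In this scaled variable the weight at s is 1 + L - ln x.\<close>
    define x where "x = (real n + 1) * (1 - s)"
    have x: "0 < x" using s by (simp add: x_def)
    have \<Omega>s: "Omega j \<beta> s = 1 + L - ln x"
      using s assms(1) by (simp add: Omega_eq L_def x_def ln_mult)
    have lx: "ln x \<le> L" using s by (simp add: L_def x_def ln_mult)
    have "1 + L \<le> exp x * (1 + L - ln x)"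
    proof (cases "x \<le> 1")
      case True
      then have "1 * (1 + L) \<le> exp x * (1 + L - ln x)"
        using x L by (intro mult_mono) auto
      then show ?thesis by simp
    next
      case False
      \<comment> \<open>(1 + ln x)(1 + L - ln x) equals 1 + L + ln x (L - ln x), so this sign gives
        the lower bound 1 + L.\<close>
      then have "0 \<le> ln x * (L - ln x)" using lx by (intro mult_nonneg_nonneg) auto
      then have "1 + L \<le> (1 + ln x) * (1 + L - ln x)" by (simp add: algebra_simps)
      also have "1 + ln x \<le> exp x" using exp_ge_add_one_self[of x] ln_le_minus_one[OF x] by linarith
      finally show ?thesis using lx by (simp add: mult_right_mono)
    qed
    then have "exp (- x) * (1 + L) \<le> 1 + L - ln x" by (simp add: exp_minus field_simps)
    have "Omega j \<beta> t * s ^ n \<le> (2 * (1 + L)) * (exp 1 * exp (- x))"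
      using \<Omega>t L power_le_exp_mult[OF s, of n] s by (intro mult_mono) (auto simp: x_def)
    also have "\<dots> = 2 * exp 1 * (exp (- x) * (1 + L))" by simp
    also have "\<dots> \<le> 2 * exp 1 * Omega j \<beta> s"
      unfolding \<Omega>s using \<open>exp (- x) * (1 + L) \<le> 1 + L - ln x\<close> by (rule mult_left_mono) simp
    finally have "Omega j \<beta> t * s ^ n / Omega j \<beta> s \<le> 2 * exp 1"
      using Omega_pos[OF s, of j \<beta>] by (simp add: field_simps)
    \<comment> \<open>The factor exp(-1) is split off to be traded for t^n.\<close>
    also have "\<dots> = (2 * exp 2) * exp (- 1)" by (simp add: exp_add[symmetric])
    also have "\<dots> \<le> (2 * exp 2) * t ^ n" using n(3) by (intro mult_left_mono) auto
    finally show ?thesis .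
  qed
  moreover have "0 < t ^ n" using n(3) by (rule less_le_trans[rotated]) simp
  ultimately show ?thesis by blast
qed

text \<open>The powers from the two weights combine to x^\<sigma> with x = (n + 1)(1 - s), and the
  exponential bound for s^n wins because x^\<sigma> exp(-x) \<le> \<sigma>^\<sigma>.\<close>

lemma Omega_le_monomials_power:
  assumes "\<beta> < real j" and t: "0 \<le> t" "t < 1"
  defines "\<sigma> \<equiv> real j - \<beta>"
  shows "\<exists>n. 0 < t ^ n \<and> (\<forall>s. 0 \<le> s \<longrightarrow> s < 1 \<longrightarrow>
    Omega j \<beta> t * s ^ n / Omega j \<beta> s \<le> (2 powr \<sigma> * exp 2 * \<sigma> powr \<sigma>) * t ^ n)"
proof -
  have \<sigma>: "0 < \<sigma>" using assms by simp
  have \<Omega>: "Omega j \<beta> s = (1 - s) powr (- \<sigma>)" if "s < 1" for s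
    using that assms by (simp add: Omega_eq \<sigma>_def)
  from monomial_index[OF t] obtain n where n: "real n + 1 \<le> 1 / (1 - t)" "1 / (1 - t) < real n + 2" "exp (- 1) \<le> t ^ n" .
  have "Omega j \<beta> t = (1 / (1 - t)) powr \<sigma>" using t by (simp add: \<Omega> powr_minus powr_divide inverse_eq_divide)
  also have "\<dots> \<le> (2 * (real n + 1)) powr \<sigma>" using n t \<sigma> by (intro powr_mono2) auto
  also have "\<dots> = 2 powr \<sigma> * (real n + 1) powr \<sigma>" by (subst powr_mult) auto
  finally have \<Omega>t: "Omega j \<beta> t \<le> 2 powr \<sigma> * (real n + 1) powr \<sigma>" .
  have "Omega j \<beta> t * s ^ n / Omega j \<beta> s \<le> (2 powr \<sigma> * exp 2 * \<sigma> powr \<sigma>) * t ^ n" if s: "0 \<le> s" "s < 1" for s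
  proof -
    define x where "x = (real n + 1) * (1 - s)"
    have x: "0 < x" using s by (simp add: x_def)
    have "(x / \<sigma>) powr \<sigma> \<le> exp (x / \<sigma>) powr \<sigma>"
    proof (rule powr_mono2)
      show "x / \<sigma> \<le> exp (x / \<sigma>)" using exp_ge_add_one_self[of "x / \<sigma>"] by linarith
    qed (use x \<sigma> in auto)
    then have xe: "x powr \<sigma> * exp (- x) \<le> \<sigma> powr \<sigma>"
      using x \<sigma> by (simp add: powr_divide exp_powr_real exp_minus field_simps)
    have "Omega j \<beta> t * s ^ n \<le> (2 powr \<sigma> * (real n + 1) powr \<sigma>) * (exp 1 * exp (- x))"
      using \<Omega>t power_le_exp_mult[OF s, of n] s by (intro mult_mono) (auto simp: x_def)
    then have "Omega j \<beta> t * s ^ n / Omega j \<beta> s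
        \<le> ((2 powr \<sigma> * (real n + 1) powr \<sigma>) * (exp 1 * exp (- x))) / Omega j \<beta> s"
      using Omega_pos[OF s, of j \<beta>] by (intro divide_right_mono) auto
    also have "\<dots> = 2 powr \<sigma> * exp 1 * (((real n + 1) powr \<sigma> * (1 - s) powr \<sigma>) * exp (- x))"
      using s by (simp add: \<Omega> powr_minus field_simps)
    also have "(real n + 1) powr \<sigma> * (1 - s) powr \<sigma> = x powr \<sigma>"
      using s by (simp add: x_def powr_mult)
    also have "2 powr \<sigma> * exp 1 * (x powr \<sigma> * exp (- x)) \<le> 2 powr \<sigma> * exp 1 * (\<sigma> powr \<sigma>)"
      by (intro mult_left_mono xe) auto
    also have "exp (1::real) = exp 2 * exp (- 1)"
      by (simp add: mult_exp_exp)
    also have "2 powr \<sigma> * (exp 2 * exp (- 1)) * \<sigma> powr \<sigma> = (2 powr \<sigma> * exp 2 * \<sigma> powr \<sigma>) * exp (- 1)"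
      by simp
    also have "\<dots> \<le> (2 powr \<sigma> * exp 2 * \<sigma> powr \<sigma>) * t ^ n" using n(3) by (intro mult_left_mono) auto
    finally show ?thesis .
  qed
  moreover have "0 < t ^ n" using n(3) by (rule less_le_trans[rotated]) simp
  ultimately show ?thesis by blast
qed

lemma Omega_le_monomials:
  assumes "\<beta> \<le> real j"
  obtains C where "0 < C" "\<And>t. 0 \<le> t \<Longrightarrow> t < 1 \<Longrightarrow> \<exists>n. 0 < t ^ n \<and> (\<forall>s. 0 \<le> s \<longrightarrow> s < 1 \<longrightarrow>
    Omega j \<beta> t * s ^ n / Omega j \<beta> s \<le> C * t ^ n)"
proof (cases "\<beta> = real j")
  case True
  then show ?thesis using Omega_le_monomials_log[of j \<beta>] by (intro that[of "2 * exp 2"]) auto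
next
  case False
  with assms have "\<beta> < real j" by simp
  then show ?thesis using Omega_le_monomials_power[of \<beta> j]
    by (intro that[of "2 powr (real j - \<beta>) * exp 2 * (real j - \<beta>) powr (real j - \<beta>)"]) auto
qed

section \<open>From pointwise bounds to quotients of norms\<close>

lemma Lambda_norm_neg_le_iff:
  assumes "\<gamma> < 0" "0 \<le> A"
  shows "Lambda_norm \<gamma> f \<le> ennreal A \<longleftrightarrow> (\<forall>z\<in>unit_disk. norm (f z) \<le> A * (1 - norm z) powr \<gamma>)"
proof -
  have "Lambda_order \<gamma> = 0" using Lambda_order_le_iff[of \<gamma> 0] assms by simp
  then show ?thesis using assms(2) Lambda_seminorm_le_iff[of A \<gamma> f] by (simp add: Lambda_norm_def)
qed

text \<open>Left to right, the index n matched to t = |\<phi> z| makes the norm of the monomial at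
  most C t^n / \<open>Omega j \<beta> t\<close>, and the positive t^n cancels. Right to left,
  |\<phi> z|^n is at most that norm times the weight.\<close>

lemma monomial_quotient_iff:
  assumes \<beta>: "\<beta> \<le> real j" and \<gamma>: "\<gamma> < 0" and im: "\<phi> ` unit_disk \<subseteq> unit_disk"
  shows "(SUP n::nat. Lambda_norm \<gamma> (\<lambda>z. G z * \<phi> z ^ n) / growth_norm (Omega j \<beta>) (\<lambda>z. z ^ n)) < \<infinity> \<longleftrightarrow>
    (\<exists>B\<ge>0. \<forall>z\<in>unit_disk. norm (G z) * Omega j \<beta> (norm (\<phi> z)) \<le> B * (1 - norm z) powr \<gamma>)"
    (is "(SUP n. ?a n / ?b n) < \<infinity> \<longleftrightarrow> ?R")
proof
  assume "(SUP n. ?a n / ?b n) < \<infinity>"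
  then obtain B where B: "0 \<le> B" "(SUP n. ?a n / ?b n) = ennreal B"
    by (cases "SUP n. ?a n / ?b n") auto
  from Omega_le_monomials[OF \<beta>] obtain C where C: "0 < C" "\<And>t. 0 \<le> t \<Longrightarrow> t < 1 \<Longrightarrow>
    \<exists>n. 0 < t ^ n \<and> (\<forall>s. 0 \<le> s \<longrightarrow> s < 1 \<longrightarrow> Omega j \<beta> t * s ^ n / Omega j \<beta> s \<le> C * t ^ n)" by blast
  have "norm (G z) * Omega j \<beta> (norm (\<phi> z)) \<le> (B * C) * (1 - norm z) powr \<gamma>" if z: "z \<in> unit_disk" for z
  proof -
    define t where "t = norm (\<phi> z)"
    have "\<phi> z \<in> unit_disk" using z im by blast
    then have t: "0 \<le> t" "t < 1" by (auto simp: t_def)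
    note \<Omega>t = Omega_pos[OF t, of j \<beta>]
    from C(2)[OF t] obtain n where n: "0 < t ^ n"
      "\<And>s. 0 \<le> s \<Longrightarrow> s < 1 \<Longrightarrow> Omega j \<beta> t * s ^ n / Omega j \<beta> s \<le> C * t ^ n" by blast
    define D where "D = C * t ^ n / Omega j \<beta> t"
    have D: "0 \<le> D" using C(1) n(1) \<Omega>t by (simp add: D_def)
    have "?b n \<le> ennreal D"
      unfolding growth_norm_def
    proof (rule SUP_least, rule ennreal_leI)
      fix x :: complex assume "x \<in> unit_disk"
      then show "norm (x ^ n) / Omega j \<beta> (norm x) \<le> D"
        using n(2)[of "norm x"] \<Omega>t by (simp add: D_def norm_power field_simps)
    qed
    then obtain b where b: "0 \<le> b" "?b n = ennreal b" "b \<le> D"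
      using D by (cases "?b n") (auto simp: top_unique)
    have ab: "?a n / ?b n \<le> ennreal B"
      unfolding B(2)[symmetric] by (rule SUP_upper) simp
    have "?a n \<le> ennreal (B * D)"
    \<comment> \<open>Division by zero gives infinity unless the numerator is zero, so the finite
      quotient forces \<open>?a n = 0\<close>.\<close>
    proof (cases "b = 0")
      case True
      then have "?a n = 0" using ab b(2) by (auto simp: ennreal_divide_zero top_unique split: if_splits)
      then show ?thesis by simp
    next
      case False
      then have "?a n = ?a n / ?b n * ?b n"
        using b(1,2) by (simp add: ennreal_divide_times ennreal_times_divide[symmetric] mult_divide_eq_ennreal)
      also have "\<dots> \<le> ennreal B * ennreal D" by (rule mult_mono) (use ab b in auto)
      finally show ?thesis using B(1) D by (simp add: ennreal_mult)
    qed
    then have "norm (G z * \<phi> z ^ n) \<le> (B * D) * (1 - norm z) powr \<gamma>"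
      using z B(1) D Lambda_norm_neg_le_iff[OF \<gamma>, of "B * D"] by fastforce
    then have "norm (G z) * t ^ n \<le> (B * C * (1 - norm z) powr \<gamma> / Omega j \<beta> t) * t ^ n"
      by (simp add: norm_mult norm_power t_def D_def mult_ac)
    then have "norm (G z) \<le> B * C * (1 - norm z) powr \<gamma> / Omega j \<beta> t"
      using n(1) by (rule mult_right_le_imp_le)
    then show ?thesis using \<Omega>t by (simp add: t_def field_simps)
  qed
  then show ?R using B(1) C(1) by (intro exI[of _ "B * C"]) auto
next
  assume ?R
  then obtain B where B: "0 \<le> B" "\<And>z. z \<in> unit_disk \<Longrightarrow>
    norm (G z) * Omega j \<beta> (norm (\<phi> z)) \<le> B * (1 - norm z) powr \<gamma>" by blast
  have "?a n / ?b n \<le> ennreal B" for n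
  proof (cases "?b n")
    case top
    then show ?thesis by simp
  next
    case (real b)
    have le: "norm x ^ n / Omega j \<beta> (norm x) \<le> b" if "x \<in> unit_disk" for x :: complex
    proof -
      have "ennreal (norm (x ^ n) / Omega j \<beta> (norm x)) \<le> ?b n"
        unfolding growth_norm_def by (rule SUP_upper[OF that])
      then show ?thesis using real by (simp add: norm_power)
    qed
    \<comment> \<open>Evaluation at 1/2 excludes a zero norm, so b can be cancelled below.\<close>
    have "0 < norm (1/2 :: complex) ^ n / Omega j \<beta> (norm (1/2 :: complex))"
      by (intro divide_pos_pos Omega_pos) auto
    also have "\<dots> \<le> b" by (rule le) simp
    finally have b: "0 < b" .
    have "norm (G z * \<phi> z ^ n) \<le> (B * b) * (1 - norm z) powr \<gamma>" if z: "z \<in> unit_disk" for z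
    proof -
      have \<phi>: "\<phi> z \<in> unit_disk" using im z by blast
      then have \<Omega>: "0 < Omega j \<beta> (norm (\<phi> z))" by (intro Omega_pos) auto
      have "norm (\<phi> z) ^ n \<le> b * Omega j \<beta> (norm (\<phi> z))"
        using le[OF \<phi>] \<Omega> by (simp add: field_simps)
      then have "norm (G z * \<phi> z ^ n) \<le> norm (G z) * (b * Omega j \<beta> (norm (\<phi> z)))"
        unfolding norm_mult norm_power by (rule mult_left_mono) simp
      also have "\<dots> = b * (norm (G z) * Omega j \<beta> (norm (\<phi> z)))" by simp
      also have "\<dots> \<le> b * (B * (1 - norm z) powr \<gamma>)" using b B(2)[OF z] by (intro mult_left_mono) auto
      finally show ?thesis by (simp add: mult_ac)
    qed
    then have "?a n \<le> ennreal (B * b)"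
      using B(1) b by (subst Lambda_norm_neg_le_iff[OF \<gamma>]) auto
    then have "?a n / ?b n \<le> ennreal (B * b) / ennreal b"
      unfolding real(2) by (rule divide_right_mono_ennreal)
    also have "\<dots> = ennreal B" using b B(1) by (simp add: divide_ennreal)
    finally show ?thesis .
  qed
  then have "(SUP n. ?a n / ?b n) \<le> ennreal B" by (intro SUP_least)
  then show "(SUP n. ?a n / ?b n) < \<infinity>" by (simp add: order_le_less_trans)
qed

section \<open>The criterion\<close>

text \<open>The identity for \<open>G\<close> bounds the J-th derivative. The lower derivatives are
  needed only at the origin, where the same identity at order i bounds them by finitely many
  numbers.\<close>

lemma bounded_Lambda_operator_if:
  assumes J: "\<alpha> < real J" and G: "is_Gcoeffs g \<phi> J G"
    and g: "g holomorphic_on unit_disk" and \<phi>: "\<phi> holomorphic_on unit_disk"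
    and im: "\<phi> ` unit_disk \<subseteq> unit_disk"
    and bd: "\<And>j. j \<le> J \<Longrightarrow> \<exists>B\<ge>0. \<forall>z\<in>unit_disk.
      norm (G j z) * Omega j \<beta> (norm (\<phi> z)) \<le> B * (1 - norm z) powr (\<alpha> - real J)"
  shows "bounded_Lambda_operator \<beta> \<alpha> (weighted_comp g \<phi>)"
proof -
  let ?T = "weighted_comp g \<phi>"
  have "\<forall>j. \<exists>C\<ge>0. \<forall>f A. 0 \<le> A \<longrightarrow> Lambda_bound \<beta> f A \<longrightarrow>
     (\<forall>z\<in>unit_disk. norm ((deriv ^^ j) f z) \<le> C * A * Omega j \<beta> (norm z))"
    using Lambda_pointwise by blast
  then obtain C where C: "\<And>j. 0 \<le> C j" "\<And>j f A z. 0 \<le> A \<Longrightarrow> Lambda_bound \<beta> f A \<Longrightarrow> z \<in> unit_disk \<Longrightarrow>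
      norm ((deriv ^^ j) f z) \<le> C j * A * Omega j \<beta> (norm z)"
    by metis
  have "\<forall>j. \<exists>B\<ge>0. j \<le> J \<longrightarrow> (\<forall>z\<in>unit_disk.
      norm (G j z) * Omega j \<beta> (norm (\<phi> z)) \<le> B * (1 - norm z) powr (\<alpha> - real J))"
    using bd by (metis order_refl)
  then obtain B where B: "\<And>j. 0 \<le> B j" "\<And>j z. j \<le> J \<Longrightarrow> z \<in> unit_disk \<Longrightarrow>
      norm (G j z) * Omega j \<beta> (norm (\<phi> z)) \<le> B j * (1 - norm z) powr (\<alpha> - real J)"
    by metis
  have "\<forall>i. \<exists>H. is_Gcoeffs g \<phi> i H"
    using is_Gcoeffs_exists[OF g \<phi> im] by blast
  then obtain H where H: "\<And>i. is_Gcoeffs g \<phi> i (H i)" by metis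
  have \<phi>0: "\<phi> 0 \<in> unit_disk" using im by force
  \<comment> \<open>\<open>E\<close> serves the J-th derivative, \<open>D i\<close> the i-th
    derivative at 0; \<open>F\<close> dominates all of them, since a single constant is
    required.\<close>
  define E where "E = (\<Sum>j\<le>J. C j * B j)"
  define D where "D i = (\<Sum>l\<le>i. norm (H i l 0) * (C l * Omega l \<beta> (norm (\<phi> 0))))" for i
  define F where "F = E + (\<Sum>i<J. D i)"
  have E: "0 \<le> E" unfolding E_def using C(1) B(1) by (intro sum_nonneg mult_nonneg_nonneg)
  have D: "0 \<le> D i" for i unfolding D_def
    using C(1) less_imp_le[OF Omega_pos] \<phi>0 by (intro sum_nonneg mult_nonneg_nonneg) auto
  have EF: "E \<le> F" unfolding F_def using D by (simp add: sum_nonneg)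
  have DF: "D i \<le> F" if "i < J" for i
    using E member_le_sum[of i "{..<J}" D] D that by (simp add: F_def)
  have F: "0 \<le> F" using E EF by simp
  from Lambda_bound_of_higher_deriv[OF J] obtain K where K: "0 \<le> K"
    "\<And>f A. 0 \<le> A \<Longrightarrow> f holomorphic_on unit_disk \<Longrightarrow> (\<And>i. i < J \<Longrightarrow> norm ((deriv ^^ i) f 0) \<le> A) \<Longrightarrow>
     (\<And>z. z \<in> unit_disk \<Longrightarrow> norm ((deriv ^^ J) f z) \<le> A * (1 - norm z) powr (\<alpha> - real J)) \<Longrightarrow>
     Lambda_bound \<alpha> f (K * A)" by blast
  have "Lambda_bound \<alpha> (?T f) ((K * F) * A)" if A: "0 \<le> A" and fA: "Lambda_bound \<beta> f A" for f A
  proof -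
    have f: "f holomorphic_on unit_disk" using fA by (simp add: Lambda_bound_def)
    have "Lambda_bound \<alpha> (?T f) (K * (F * A))"
    proof (rule K(2))
      show "0 \<le> F * A" using F A by simp
      show "?T f holomorphic_on unit_disk" by (rule weighted_comp_holomorphic[OF g \<phi> im f])
      show "norm ((deriv ^^ i) (?T f) 0) \<le> F * A" if i: "i < J" for i
      proof -
        have "(deriv ^^ i) (?T f) 0 = (\<Sum>l\<le>i. H i l 0 * (deriv ^^ l) f (\<phi> 0))"
          using H[of i] f unfolding is_Gcoeffs_def by simp
        also have "norm \<dots> \<le> (\<Sum>l\<le>i. norm (H i l 0) * (C l * A * Omega l \<beta> (norm (\<phi> 0))))"
          using C(2)[OF A fA \<phi>0] by (intro sum_norm_le) (auto simp: norm_mult intro: mult_left_mono)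
        also have "\<dots> = D i * A" 
          unfolding D_def sum_distrib_right by (intro sum.cong refl) simp
        also have "\<dots> \<le> F * A" by (rule mult_right_mono[OF DF[OF i] A])
        finally show ?thesis .
      qed
      show "norm ((deriv ^^ J) (?T f) z) \<le> F * A * (1 - norm z) powr (\<alpha> - real J)"
        if z: "z \<in> unit_disk" for z
      proof -
        have \<phi>z: "\<phi> z \<in> unit_disk" using im z by blast
        have "(deriv ^^ J) (?T f) z = (\<Sum>j\<le>J. G j z * (deriv ^^ j) f (\<phi> z))"
          using G f z unfolding is_Gcoeffs_def by blast
        also have "norm \<dots> \<le> (\<Sum>j\<le>J. (C j * A) * (B j * (1 - norm z) powr (\<alpha> - real J)))"
        proof (rule sum_norm_le)
          fix j assume "j \<in> {..J}"
          then have j: "j \<le> J" by simp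
          have "norm (G j z * (deriv ^^ j) f (\<phi> z)) \<le> norm (G j z) * (C j * A * Omega j \<beta> (norm (\<phi> z)))"
            unfolding norm_mult by (intro mult_left_mono C(2)[OF A fA \<phi>z]) auto
          also have "\<dots> = (C j * A) * (norm (G j z) * Omega j \<beta> (norm (\<phi> z)))" by simp
          also have "\<dots> \<le> (C j * A) * (B j * (1 - norm z) powr (\<alpha> - real J))"
            using A C(1) by (intro mult_left_mono B(2)[OF j z]) auto
          finally show "norm (G j z * (deriv ^^ j) f (\<phi> z)) \<le> (C j * A) * (B j * (1 - norm z) powr (\<alpha> - real J))" .
        qed
        also have "\<dots> = E * (A * (1 - norm z) powr (\<alpha> - real J))"
          unfolding E_def sum_distrib_right by (intro sum.cong refl) simp
        also have "\<dots> \<le> F * (A * (1 - norm z) powr (\<alpha> - real J))"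
          using A by (intro mult_right_mono EF) auto
        finally show ?thesis by (simp add: mult.assoc)
      qed
    qed
    then show ?thesis by (simp add: mult.assoc)
  qed
  moreover have "0 \<le> K * F" using K(1) F by simp
  ultimately show ?thesis
    using bounded_Lambda_operator_iff[of ?T] weighted_comp_holomorphic[OF g \<phi> im] by blast
qed

text \<open>
  Downward induction on \<open>j\<close>: a test function vanishing to order \<open>j\<close> at \<open>\<phi> z\<close> leaves only the
  terms with index \<open>\<ge> j\<close>, and those with index \<open>> j\<close> are controlled by the induction hypothesis.
\<close>

lemma bounded_Lambda_operator_imp:
  assumes J: "\<alpha> < real J" and G: "is_Gcoeffs g \<phi> J G"
    and g: "g holomorphic_on unit_disk" and \<phi>: "\<phi> holomorphic_on unit_disk"
    and im: "\<phi> ` unit_disk \<subseteq> unit_disk"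
    and bounded: "bounded_Lambda_operator \<beta> \<alpha> (weighted_comp g \<phi>)"
    and "j \<le> J"
  shows "\<exists>B\<ge>0. \<forall>z\<in>unit_disk. norm (G j z) * Omega j \<beta> (norm (\<phi> z)) \<le> B * (1 - norm z) powr (\<alpha> - real J)"
  using \<open>j \<le> J\<close>
proof (induction "J - j" arbitrary: j rule: less_induct)
  case less
  let ?T = "weighted_comp g \<phi>"
  from bounded obtain M where M: "0 \<le> M"
    "\<And>f A. 0 \<le> A \<Longrightarrow> Lambda_bound \<beta> f A \<Longrightarrow> Lambda_bound \<alpha> (?T f) (M * A)"
    using bounded_Lambda_operator_iff weighted_comp_holomorphic[OF g \<phi> im] by blast
  \<comment> \<open>To be applied to the image \<open>?T f\<close>: as \<alpha> < J,
    \<open>Omega J \<alpha>\<close> is the weight of the claim.\<close>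
  from Lambda_pointwise[of \<alpha> J] obtain M' where M': "0 \<le> M'"
    "\<And>f A z. 0 \<le> A \<Longrightarrow> Lambda_bound \<alpha> f A \<Longrightarrow> z \<in> unit_disk \<Longrightarrow>
      norm ((deriv ^^ J) f z) \<le> M' * A * Omega J \<alpha> (norm z)" by blast
  have "\<forall>j. \<exists>C\<ge>0. \<forall>f A. 0 \<le> A \<longrightarrow> Lambda_bound \<beta> f A \<longrightarrow>
     (\<forall>z\<in>unit_disk. norm ((deriv ^^ j) f z) \<le> C * A * Omega j \<beta> (norm z))"
    using Lambda_pointwise by blast
  then obtain C where C: "\<And>j. 0 \<le> C j" "\<And>j f A z. 0 \<le> A \<Longrightarrow> Lambda_bound \<beta> f A \<Longrightarrow> z \<in> unit_disk \<Longrightarrow>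
      norm ((deriv ^^ j) f z) \<le> C j * A * Omega j \<beta> (norm z)"
    by metis
  have "\<exists>B\<ge>0. i \<in> {j<..J} \<longrightarrow> (\<forall>z\<in>unit_disk.
      norm (G i z) * Omega i \<beta> (norm (\<phi> z)) \<le> B * (1 - norm z) powr (\<alpha> - real J))" for i
  proof (cases "i \<in> {j<..J}")
    case True
    then show ?thesis using less.hyps[of i] by auto
  qed auto
  then obtain B where B: "\<And>i. 0 \<le> B i" "\<And>i z. i \<in> {j<..J} \<Longrightarrow> z \<in> unit_disk \<Longrightarrow>
      norm (G i z) * Omega i \<beta> (norm (\<phi> z)) \<le> B i * (1 - norm z) powr (\<alpha> - real J)"
    by metis
  \<comment> \<open>\<open>A\<close> and \<open>c\<close> do not depend on w, which makes the final
    bound uniform in z.\<close>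
  from test_function[of \<beta> j] obtain A c where A: "0 \<le> A" and c: "0 < c" and tf: "\<And>w. w \<in> unit_disk \<Longrightarrow>
    \<exists>f. Lambda_bound \<beta> f A \<and> (\<forall>i<j. (deriv ^^ i) f w = 0) \<and> c * Omega j \<beta> (norm w) \<le> norm ((deriv ^^ j) f w)"
    by blast
  \<comment> \<open>The first summand comes from the J-th derivative of the image, the sum from the
    terms with index above j.\<close>
  define F where "F = M' * (M * A) + (\<Sum>i\<in>{j<..J}. (C i * A) * B i)"
  have F: "0 \<le> F" unfolding F_def using M(1) M'(1) A B(1) C(1)
    by (intro add_nonneg_nonneg sum_nonneg mult_nonneg_nonneg) auto
  have "norm (G j z) * Omega j \<beta> (norm (\<phi> z)) \<le> (F / c) * (1 - norm z) powr (\<alpha> - real J)"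
    if z: "z \<in> unit_disk" for z
  proof -
    define u where "u = (1 - norm z) powr (\<alpha> - real J)"
    have \<phi>z: "\<phi> z \<in> unit_disk" using im z by blast
    from tf[OF \<phi>z] obtain f where fA: "Lambda_bound \<beta> f A" and 0: "\<And>i. i < j \<Longrightarrow> (deriv ^^ i) f (\<phi> z) = 0"
      and lower: "c * Omega j \<beta> (norm (\<phi> z)) \<le> norm ((deriv ^^ j) f (\<phi> z))" by blast
    have f: "f holomorphic_on unit_disk" using fA by (simp add: Lambda_bound_def)
    let ?R = "\<Sum>i\<in>{j<..J}. G i z * (deriv ^^ i) f (\<phi> z)"
    have "(deriv ^^ J) (?T f) z = (\<Sum>i\<le>J. G i z * (deriv ^^ i) f (\<phi> z))"
      using G f z unfolding is_Gcoeffs_def by blast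
    also have "\<dots> = (\<Sum>i\<in>insert j {j<..J}. G i z * (deriv ^^ i) f (\<phi> z))"
      using less.prems 0 by (intro sum.mono_neutral_right) (auto simp: not_less)
    also have "\<dots> = G j z * (deriv ^^ j) f (\<phi> z) + ?R" by simp
    finally have eq: "G j z * (deriv ^^ j) f (\<phi> z) = (deriv ^^ J) (?T f) z - ?R" by simp
    have "c * (norm (G j z) * Omega j \<beta> (norm (\<phi> z))) \<le> norm (G j z) * norm ((deriv ^^ j) f (\<phi> z))"
      using mult_left_mono[OF lower norm_ge_zero[of "G j z"]] by (simp add: mult_ac)
    also have "\<dots> \<le> norm ((deriv ^^ J) (?T f) z) + norm ?R"
      unfolding norm_mult[symmetric] eq by (rule norm_triangle_ineq4)
    also have "norm ((deriv ^^ J) (?T f) z) \<le> M' * (M * A) * Omega J \<alpha> (norm z)"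
      using M(1) A by (intro M'(2) M(2) fA z) auto
    also have "Omega J \<alpha> (norm z) = u" using z J by (simp add: Omega_eq u_def)
    also have "norm ?R \<le> (\<Sum>i\<in>{j<..J}. (C i * A) * (B i * u))"
    proof (rule sum_norm_le)
      fix i assume i: "i \<in> {j<..J}"
      have "norm (G i z * (deriv ^^ i) f (\<phi> z)) \<le> norm (G i z) * (C i * A * Omega i \<beta> (norm (\<phi> z)))"
        unfolding norm_mult by (intro mult_left_mono C(2)[OF A fA \<phi>z]) auto
      also have "\<dots> = (C i * A) * (norm (G i z) * Omega i \<beta> (norm (\<phi> z)))" by simp
      also have "\<dots> \<le> (C i * A) * (B i * u)"
        unfolding u_def using A C(1) by (intro mult_left_mono B(2)[OF i z]) auto
      finally show "norm (G i z * (deriv ^^ i) f (\<phi> z)) \<le> (C i * A) * (B i * u)" .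
    qed
    also have "M' * (M * A) * u + (\<Sum>i\<in>{j<..J}. (C i * A) * (B i * u)) = F * u"
      unfolding F_def distrib_right sum_distrib_right by (simp add: mult.assoc)
    finally have "c * (norm (G j z) * Omega j \<beta> (norm (\<phi> z))) \<le> F * u" by simp
    then show ?thesis using c by (simp add: u_def field_simps)
  qed
  then show ?case using F c by (intro exI[of _ "F / c"]) auto
qed

theorem corollary2p3:
  fixes \<alpha> \<beta> :: real and J N :: nat and g \<phi> :: "complex \<Rightarrow> complex"
  assumes "real J > \<alpha>"
    and "N = min_nat_ge \<beta>"
    and "g holomorphic_on unit_disk"
    and "\<phi> holomorphic_on unit_disk"
    and "\<phi> ` unit_disk \<subseteq> unit_disk"
  shows "bounded_Lambda_operator \<beta> \<alpha> (weighted_comp g \<phi>) \<longleftrightarrow>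
    (\<forall>j. j < N \<and> j \<le> J \<longrightarrow> Gcoeff g \<phi> J j \<in> Lambda_space (\<alpha> - real J)) \<and>
    (\<forall>j\<in>{N..J}.
       (SUP n::nat. Lambda_norm (\<alpha> - real J) (\<lambda>z. Gcoeff g \<phi> J j z * \<phi> z ^ n) /
          growth_norm (Omega j \<beta>) (\<lambda>z. z ^ n)) < \<infinity>)"
proof -
  let ?G = "Gcoeff g \<phi> J"
  define \<gamma> where "\<gamma> = \<alpha> - real J"
  have \<gamma>: "\<gamma> < 0" using assms(1) by (simp add: \<gamma>_def)
  have G: "is_Gcoeffs g \<phi> J ?G"
    unfolding Gcoeff_def by (rule someI_ex[OF is_Gcoeffs_exists[OF assms(3-5)]])
  \<comment> \<open>The pointwise condition through which boundedness and both listed conditions are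
    compared.\<close>
  define P where "P j \<longleftrightarrow> (\<exists>B\<ge>0. \<forall>z\<in>unit_disk.
    norm (?G j z) * Omega j \<beta> (norm (\<phi> z)) \<le> B * (1 - norm z) powr \<gamma>)" for j
  have "bounded_Lambda_operator \<beta> \<alpha> (weighted_comp g \<phi>) \<longleftrightarrow> (\<forall>j\<le>J. P j)"
    unfolding P_def \<gamma>_def
    using bounded_Lambda_operator_if[OF assms(1) G assms(3-5)]
      bounded_Lambda_operator_imp[OF assms(1) G assms(3-5)] by blast
  moreover have "?G j \<in> Lambda_space \<gamma> \<longleftrightarrow> P j" if "j < N" "j \<le> J" for j
  proof -
    \<comment> \<open>Below \<open>N\<close> the weight is 1, so \<open>P j\<close> reduces to
      finiteness of the norm with index \<gamma>.\<close>
    have "Omega j \<beta> (norm (\<phi> z)) = 1" for z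
      using that assms(2) by (simp add: Omega_def)
    then have P: "P j \<longleftrightarrow> (\<exists>B\<ge>0. Lambda_norm \<gamma> (?G j) \<le> ennreal B)"
      unfolding P_def using Lambda_norm_neg_le_iff[OF \<gamma>] by auto
    have hol: "?G j holomorphic_on unit_disk" using G that by (simp add: is_Gcoeffs_def)
    show ?thesis
    proof
      assume "?G j \<in> Lambda_space \<gamma>"
      then have "Lambda_norm \<gamma> (?G j) < \<infinity>" by (rule Lambda_space_imp_norm_finite)
      then show "P j" unfolding P by (cases "Lambda_norm \<gamma> (?G j)") auto
    next
      assume "P j"
      then show "?G j \<in> Lambda_space \<gamma>"
        unfolding P using Lambda_norm_imp_bound[OF hol] Lambda_bound_imp_space(1) by blast
    qed
  qed
  moreover have "(SUP n::nat. Lambda_norm \<gamma> (\<lambda>z. ?G j z * \<phi> z ^ n) /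
      growth_norm (Omega j \<beta>) (\<lambda>z. z ^ n)) < \<infinity> \<longleftrightarrow> P j" if "j \<in> {N..J}" for j
  proof -
    have "\<beta> \<le> real j" using that assms(2) less_min_nat_ge_iff[of j \<beta>] by auto
    then show ?thesis unfolding P_def by (rule monomial_quotient_iff[OF _ \<gamma> assms(5)])
  qed
  moreover have "(\<forall>j\<le>J. P j) \<longleftrightarrow> (\<forall>j. j < N \<and> j \<le> J \<longrightarrow> P j) \<and> (\<forall>j\<in>{N..J}. P j)"
    by (meson atLeastAtMost_iff not_less)
  ultimately show ?thesis
    unfolding \<gamma>_def[symmetric] by simp
qed

end
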